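(* Let $\mathscr P_\bullet$ be a planar algebra over a field $k$ which is generated by its 2-box space, and suppose that its 2-box space has a Yang-Baxter relation. Then $\mathscr P_\bullet$ is evaluable by the type I, II, III moves of 2-boxes: using these moves (and linearity) every closed tangle labelled by 2-boxes is reduced to a scalar multiple of the empty diagram, and every $m$-box space is reduced to a finite dimensional space. Consequently, the planar algebra (i.e. the value of every closed tangle labelled by 2-boxes) is determined by the structure constants of 2-boxes and the duality coefficients of the Yang-Baxter relation.
   Context: A (shaded) planar algebra over $k$ is a family of vector spaces $\mathscr P_{m,\pm}$ ($m\ge0$) on which shaded planar tangles act by multilinear maps, compatibly with isotopy and composition of tangles, with $\mathscr P_{0,\pm}$ one-dimensional spanned by the empty diagram. Elements of $\mathscr P_{m,\pm}$ are $m$-boxes (rectangles with $m$ bottom and $m$ top boundary points); $xy$ is vertical stacking, $x\otimes y$ is horizontal juxtaposition, $1$ is a through string. The 1-box and 2-box spaces are finite dimensional, with fixed bases $\{s_i\}$ and $\{x_j\}$. Generated by the 2-box space means every box is a linear combination of planar tangles labelled by 2-boxes. The moves. Type I: joining two adjacent boundary points of a 2-box $x_j$ by an arc gives a 1-box $\sum_i b_j^i s_i$; type I': closing up a 1-box $s_i$ gives a scalar $b_i$. Type II: joining two 2-boxes $x_j,x_k$ (with compatible shading) along two adjacent strings (e.g. multiplying them) gives $\sum_l b_{jk}^l x_l$; type II': attaching a 1-box $s_i$ to one of the four boundary points of a 2-box $x_j$ gives $\sum_k b(l)_{ij}^k x_k$, $l=1,2,3,4$. The coefficients in moves I, I', II,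 II' are the structure constants of 2-boxes. Yang-Baxter relation (type III move): for all basis 2-boxes $R_i,R_j,R_k$ with compatible shading (for both shadings), $$(1\otimes R_i)(R_j\otimes1)(1\otimes R_k)=\sum_{i',j',k'}c_{i,j,k}^{i',j',k'}(R_{k'}\otimes1)(1\otimes R_{j'})(R_{i'}\otimes1),$$ with $c_{i,j,k}^{i',j',k'}\in k$ (the duality coefficients) and $R_{i'},R_{j'},R_{k'}$ in the basis of 2-boxes. *)

theory Defs
  imports Complex_Main "HOL-Library.Poly_Mapping"
begin

section \<open>Labelled shaded planar tangles\<close>

text \<open>
  Tangles are drawn in rectangles in standard form: a word of layers, read from bottom to top.  A
  layer \<open>(p, c)\<close> has \<open>p\<close> through strings to the left of the piece \<open>c\<close> and only through strings to
  the right of it.  Boxes are rectangles with \<open>k\<close> bottom and \<open>k\<close> top boundary points and with the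
  distinguished boundary interval on the left; a box in any other position is written with the help
  of cups and caps.  Tangles up to planar isotopy are words up to the relation \<open>isotopic\<close> below.
\<close>

datatype 'l piece = Cup | Cap | Box nat 'l

type_synonym 'l tangle = "(nat \<times> 'l piece) list"

fun ins :: "'l piece \<Rightarrow> nat" where
  "ins Cup = 0"
| "ins Cap = 2"
| "ins (Box k v) = k"

fun outs :: "'l piece \<Rightarrow> nat" where
  "outs Cup = 2"
| "outs Cap = 0"
| "outs (Box k v) = k"

text \<open>The two shadings \<open>+\<close>, \<open>-\<close> are the two Booleans.  If the leftmost region has shading \<open>s\<close>, then
  the region to the right of the first \<open>p\<close> strings has shading \<open>shade_at s p\<close>.  The shading of a box
  is the shading of the region on its left.\<close>

definition shade_at :: "bool \<Rightarrow> nat \<Rightarrow> bool" where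
  "shade_at s p = (if even p then s else \<not> s)"

text \<open>\<open>wf_tangle L s m T n\<close>: \<open>T\<close> is a tangle with leftmost region of shading \<open>s\<close>, with \<open>m\<close> bottom and
  \<open>n\<close> top boundary points, all of whose \<open>k\<close>-boxes of shading \<open>t\<close> are labelled by elements of
  \<open>L k t\<close>.\<close>

fun wf_tangle :: "(nat \<Rightarrow> bool \<Rightarrow> 'l set) \<Rightarrow> bool \<Rightarrow> nat \<Rightarrow> 'l tangle \<Rightarrow> nat \<Rightarrow> bool" where
  "wf_tangle L s m [] n \<longleftrightarrow> m = n"
| "wf_tangle L s m ((p, c) # T) n \<longleftrightarrow>
     p + ins c \<le> m \<and>
     (case c of Box k v \<Rightarrow> v \<in> L k (shade_at s p) | _ \<Rightarrow> True) \<and>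
     wf_tangle L s (m - ins c + outs c) T n"

definition place :: "nat \<Rightarrow> 'l tangle \<Rightarrow> 'l tangle" where
  "place p T = map (\<lambda>(q, c). (p + q, c)) T"

definition fill :: "('l \<Rightarrow> 'v) \<Rightarrow> 'l tangle \<Rightarrow> 'v tangle" where
  "fill f T = map (\<lambda>(p, c). (p, map_piece f c)) T"

text \<open>\<open>m\<close> nested cups inserted at position \<open>p\<close>, and \<open>m\<close> nested caps on the \<open>2 * m\<close> strings following
  the first \<open>p\<close>.\<close>

definition nested_cups :: "nat \<Rightarrow> nat \<Rightarrow> 'l tangle" where
  "nested_cups p m = map (\<lambda>i. (p + i, Cup)) [0..<m]"

definition nested_caps :: "nat \<Rightarrow> nat \<Rightarrow> 'l tangle" where
  "nested_caps p m = map (\<lambda>i. (p + i, Cap)) (rev [0..<m])"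

text \<open>Generators of planar isotopy: exchange of two layers whose pieces are horizontally disjoint,
  straightening of a zigzag, and equality of the two half turns (clockwise and counterclockwise) of
  a box, i.e. invariance under a full turn.\<close>

inductive isotopy_gen :: "'l tangle \<Rightarrow> 'l tangle \<Rightarrow> bool" where
  exchange: "p + outs c \<le> q \<Longrightarrow>
     isotopy_gen [(p, c), (q, d)] [(q - outs c + ins c, d), (p, c)]"
| zigzag_left: "isotopy_gen [(p, Cup), (Suc p, Cap)] []"
| zigzag_right: "isotopy_gen [(Suc p, Cup), (p, Cap)] []"
| half_turn: "isotopy_gen
     (nested_cups p k @ [(p + k, Box k v)] @ nested_caps (p + k) k)
     (nested_cups (p + k) k @ [(p + k, Box k v)] @ nested_caps p k)"

definition isotopic ::
  "(nat \<Rightarrow> bool \<Rightarrow> 'l set) \<Rightarrow> bool \<Rightarrow> nat \<Rightarrow> nat \<Rightarrow> 'l tangle \<Rightarrow> 'l tangle \<Rightarrow> bool" where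
  "isotopic L s m n = equivclp (\<lambda>T U. wf_tangle L s m T n \<and> wf_tangle L s m U n \<and>
     (\<exists>A B u v. isotopy_gen u v \<and> T = A @ u @ B \<and> U = A @ v @ B))"

section \<open>Planar algebras\<close>

text \<open>
  The spaces \<open>P m s\<close> are subspaces of one ambient vector space.  \<open>Z s m T\<close> is the value in \<open>P m s\<close> of
  a tangle \<open>T\<close> with \<open>m\<close> bottom and \<open>m\<close> top boundary points whose input boxes are filled with
  vectors.  Thus the multilinear map of a tangle \<open>T\<close> with input boxes indexed by \<open>i\<close>
  is \<open>\<lambda>v. Z s m (fill v T)\<close>.
\<close>

locale planar_algebra = vector_space scale
  for scale :: "'k::field \<Rightarrow> 'v::ab_group_add \<Rightarrow> 'v" +
  fixes P :: "nat \<Rightarrow> bool \<Rightarrow> 'v set"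
    and Z :: "bool \<Rightarrow> nat \<Rightarrow> 'v tangle \<Rightarrow> 'v"
  assumes subspace_P: "subspace (P m s)"
    and Z_in_P: "wf_tangle P s m T m \<Longrightarrow> Z s m T \<in> P m s"
    and Z_add: "\<lbrakk>wf_tangle P s m (A @ (p, Box k u) # B) m; wf_tangle P s m (A @ (p, Box k v) # B) m\<rbrakk>
      \<Longrightarrow> Z s m (A @ (p, Box k (u + v)) # B)
          = Z s m (A @ (p, Box k u) # B) + Z s m (A @ (p, Box k v) # B)"
    and Z_scale: "wf_tangle P s m (A @ (p, Box k u) # B) m
      \<Longrightarrow> Z s m (A @ (p, Box k (scale a u)) # B) = scale a (Z s m (A @ (p, Box k u) # B))"
    and Z_isotopic: "\<lbrakk>wf_tangle P s m T m; isotopic P s m m T U\<rbrakk> \<Longrightarrow> Z s m T = Z s m U"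
    and Z_identity: "v \<in> P k s \<Longrightarrow> Z s k [(0, Box k v)] = v"
    and Z_compose: "\<lbrakk>wf_tangle P (shade_at s p) k S k;
        wf_tangle P s m (A @ (p, Box k (Z (shade_at s p) k S)) # B) m\<rbrakk>
      \<Longrightarrow> Z s m (A @ (p, Box k (Z (shade_at s p) k S)) # B) = Z s m (A @ place p S @ B)"
    and P0_one_dim: "Z s 0 [] \<noteq> 0" "P 0 s = span {Z s 0 []}"

definition two_box_labels :: "(bool \<Rightarrow> 'l set) \<Rightarrow> nat \<Rightarrow> bool \<Rightarrow> 'l set" where
  "two_box_labels L k s = (if k = 2 then L s else {})"

definition one_two_box_labels :: "(nat \<Rightarrow> bool \<Rightarrow> 'l set) \<Rightarrow> nat \<Rightarrow> bool \<Rightarrow> 'l set" where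
  "one_two_box_labels L k s = (if k = 1 \<or> k = 2 then L k s else {})"

section \<open>The moves\<close>

text \<open>\<open>turn k r T\<close> is the tangle \<open>T\<close>, with \<open>k\<close> bottom and \<open>k\<close> top points, rotated by \<open>r\<close> of the \<open>2 * k\<close>
  steps of a full turn; if \<open>T\<close> has shading \<open>s\<close>, then \<open>turn k r T\<close> has shading \<open>shade_at s r\<close>.
  \<open>close_right k T\<close> joins the rightmost top and bottom points of \<open>T\<close>.\<close>

definition turn :: "nat \<Rightarrow> nat \<Rightarrow> 'l tangle \<Rightarrow> 'l tangle" where
  "turn k r = (\<lambda>T. [(0, Cup)] @ place 1 T @ [(k, Cap)]) ^^ r"

definition close_right :: "nat \<Rightarrow> 'l tangle \<Rightarrow> 'l tangle" where
  "close_right k T = [(k - 1, Cup)] @ T @ [(k - 1, Cap)]"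

definition box :: "nat \<Rightarrow> 'l \<Rightarrow> 'l tangle" where
  "box k v = [(0, Box k v)]"

text \<open>\<open>x y\<close> is \<open>x\<close> stacked on top of \<open>y\<close>; words are read from the bottom.\<close>

definition stack :: "'l tangle \<Rightarrow> 'l tangle \<Rightarrow> 'l tangle" where
  "stack T U = U @ T"

text \<open>Coefficients of the moves, indexed by \<open>'i\<close> (basis of 1-boxes) and \<open>'j\<close> (basis of 2-boxes).  The
  Boolean in front of an index is the shading of that box; the natural number after it says
  by how many steps it is turned.  In \<open>coeff_II'\<close> the arguments \<open>c\<close> (left 0, right 1)
  and \<open>top\<close> name the four boundary points of a 2-box.\<close>

record ('i, 'j, 'k) coeffs =
  coeff_I :: "bool \<Rightarrow> 'j \<Rightarrow> nat \<Rightarrow> 'i \<Rightarrow> 'k"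
  coeff_I' :: "bool \<Rightarrow> 'i \<Rightarrow> nat \<Rightarrow> 'k"
  coeff_II :: "bool \<Rightarrow> 'j \<Rightarrow> nat \<Rightarrow> bool \<Rightarrow> 'j \<Rightarrow> nat \<Rightarrow> 'j \<Rightarrow> 'k"
  coeff_II' :: "bool \<Rightarrow> 'i \<Rightarrow> bool \<Rightarrow> 'j \<Rightarrow> nat \<Rightarrow> bool \<Rightarrow> 'j \<Rightarrow> 'k"
  coeff_III :: "bool \<Rightarrow> 'j \<Rightarrow> 'j \<Rightarrow> 'j \<Rightarrow> 'j \<Rightarrow> 'j \<Rightarrow> 'j \<Rightarrow> 'k"

text \<open>
  \<open>I s\<close>, \<open>J s\<close> are the index sets of the bases of the 1-box and 2-box spaces of shading \<open>s\<close>.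
  \<open>type_I_II_move I S J X K t k T g\<close>: the tangle \<open>T\<close>, of shading \<open>t\<close> with \<open>k\<close> bottom and \<open>k\<close> top points,
  is to be replaced by the formal linear combination \<open>g\<close>.  Every pair of adjacent boundary points of
  a 2-box is the right-hand, and the top or bottom, pair of one of its four turns.  A 1-box can be
  closed up on its right or (after a half turn) on its left.  A 1-box fits on a given boundary point
  of a 2-box either upright or, if the shadings do not match, after a half turn.
\<close>

inductive type_I_II_move ::
  "(bool \<Rightarrow> 'i set) \<Rightarrow> ('i \<Rightarrow> 'v) \<Rightarrow> (bool \<Rightarrow> 'j set) \<Rightarrow> ('j \<Rightarrow> 'v) \<Rightarrow> ('i, 'j, 'k::field) coeffs \<Rightarrow>
   bool \<Rightarrow> nat \<Rightarrow> 'v tangle \<Rightarrow> ('v tangle \<Rightarrow>\<^sub>0 'k) \<Rightarrow> bool"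
  for I :: "bool \<Rightarrow> 'i set" and S :: "'i \<Rightarrow> 'v" and J :: "bool \<Rightarrow> 'j set" and X :: "'j \<Rightarrow> 'v"
    and K :: "('i, 'j, 'k) coeffs"
where
  type_I: "\<lbrakk>j \<in> J s; r < 4\<rbrakk> \<Longrightarrow>
    type_I_II_move I S J X K (shade_at s r) 1
      (close_right 2 (turn 2 r (box 2 (X j))))
      (\<Sum>i\<in>I (shade_at s r). Poly_Mapping.single (box 1 (S i)) (coeff_I K s j r i))"
| type_I': "\<lbrakk>i \<in> I s; r < 2\<rbrakk> \<Longrightarrow>
    type_I_II_move I S J X K (shade_at s r) 0
      (close_right 1 (turn 1 r (box 1 (S i))))
      (Poly_Mapping.single [] (coeff_I' K s i r))"
| type_II: "\<lbrakk>j \<in> J s; r < 4; k \<in> J s'; r' < 4; shade_at s r = t; shade_at s' r' = t\<rbrakk> \<Longrightarrow>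
    type_I_II_move I S J X K t 2
      (stack (turn 2 r (box 2 (X j))) (turn 2 r' (box 2 (X k))))
      (\<Sum>l\<in>J t. Poly_Mapping.single (box 2 (X l)) (coeff_II K s j r s' k r' l))"
| type_II': "\<lbrakk>i \<in> I s; j \<in> J t; c < 2; r < 2; shade_at s r = shade_at t c;
      U = place c (turn 1 r (box 1 (S i)))\<rbrakk> \<Longrightarrow>
    type_I_II_move I S J X K t 2
      (if top then stack U (box 2 (X j)) else stack (box 2 (X j)) U)
      (\<Sum>k\<in>J t. Poly_Mapping.single (box 2 (X k)) (coeff_II' K s i t j c top k))"

inductive type_III_move ::
  "(bool \<Rightarrow> 'j set) \<Rightarrow> ('j \<Rightarrow> 'v) \<Rightarrow> ('i, 'j, 'k::field) coeffs \<Rightarrow>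
   bool \<Rightarrow> nat \<Rightarrow> 'v tangle \<Rightarrow> ('v tangle \<Rightarrow>\<^sub>0 'k) \<Rightarrow> bool"
  for J :: "bool \<Rightarrow> 'j set" and X :: "'j \<Rightarrow> 'v" and K :: "('i, 'j, 'k) coeffs"
where
  type_III: "\<lbrakk>i \<in> J (\<not> t); j \<in> J t; k \<in> J (\<not> t)\<rbrakk> \<Longrightarrow>
    type_III_move J X K t 3
      (stack (place 1 (box 2 (X i))) (stack (box 2 (X j)) (place 1 (box 2 (X k)))))
      (\<Sum>i'\<in>J t. \<Sum>j'\<in>J (\<not> t). \<Sum>k'\<in>J t.
        Poly_Mapping.single
          (stack (box 2 (X k')) (stack (place 1 (box 2 (X j'))) (box 2 (X i'))))
          (coeff_III K t i j k i' j' k'))"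

definition relation_holds ::
  "('k::field \<Rightarrow> 'v \<Rightarrow> 'v::ab_group_add) \<Rightarrow> (bool \<Rightarrow> nat \<Rightarrow> 'v tangle \<Rightarrow> 'v) \<Rightarrow>
   bool \<Rightarrow> nat \<Rightarrow> 'v tangle \<Rightarrow> ('v tangle \<Rightarrow>\<^sub>0 'k) \<Rightarrow> bool" where
  "relation_holds scale Z t k T g \<longleftrightarrow>
     Z t k T = (\<Sum>U\<in>Poly_Mapping.keys g. scale (Poly_Mapping.lookup g U) (Z t k U))"

locale two_box_yang_baxter = planar_algebra scale P Z
  for scale :: "'k::field \<Rightarrow> 'v::ab_group_add \<Rightarrow> 'v"
    and P :: "nat \<Rightarrow> bool \<Rightarrow> 'v set"
    and Z :: "bool \<Rightarrow> nat \<Rightarrow> 'v tangle \<Rightarrow> 'v" +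
  fixes I :: "bool \<Rightarrow> 'i set" and S :: "'i \<Rightarrow> 'v"
    and J :: "bool \<Rightarrow> 'j set" and X :: "'j \<Rightarrow> 'v"
    and K :: "('i, 'j, 'k) coeffs"
  assumes one_box_basis:
      "finite (I s)" "inj_on S (I s)" "independent (S ` I s)" "span (S ` I s) = P 1 s"
    and two_box_basis:
      "finite (J s)" "inj_on X (J s)" "independent (X ` J s)" "span (X ` J s) = P 2 s"
    and generated_by_two_boxes:
      "P m s = span {Z s m T |T. wf_tangle (two_box_labels (P 2)) s m T m}"
    and structure_constants:
      "type_I_II_move I S J X K t k T g \<Longrightarrow> relation_holds scale Z t k T g"
    and yang_baxter_relation:
      "type_III_move J X K t k T g \<Longrightarrow> relation_holds scale Z t k T g"

text \<open>
  \<open>move \<dots> s m T g\<close>: one step of the evaluation replaces \<open>T\<close> by the formal linear combination \<open>g\<close>, by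
  isotopy, by one of the moves applied inside a larger tangle, or by linearity.  Linearity
  means multilinearity in the labels, where one or two parallel through strings may
  also be viewed as a 1-box or 2-box (labelled by the identity); it is in this way that a circle
  without boxes is a closed-up 1-box.
\<close>

inductive move ::
  "('k::field \<Rightarrow> 'v \<Rightarrow> 'v::ab_group_add) \<Rightarrow> (nat \<Rightarrow> bool \<Rightarrow> 'v set) \<Rightarrow>
   (bool \<Rightarrow> nat \<Rightarrow> 'v tangle \<Rightarrow> 'v) \<Rightarrow>
   (bool \<Rightarrow> 'i set) \<Rightarrow> ('i \<Rightarrow> 'v) \<Rightarrow> (bool \<Rightarrow> 'j set) \<Rightarrow> ('j \<Rightarrow> 'v) \<Rightarrow> ('i, 'j, 'k) coeffs \<Rightarrow>
   bool \<Rightarrow> nat \<Rightarrow> 'v tangle \<Rightarrow> ('v tangle \<Rightarrow>\<^sub>0 'k) \<Rightarrow> bool"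
  for scale P Z I S J X K s m
where
  isotopy: "\<lbrakk>wf_tangle (one_two_box_labels P) s m T m;
      isotopic (one_two_box_labels P) s m m T U\<rbrakk> \<Longrightarrow>
    move scale P Z I S J X K s m T (Poly_Mapping.single U 1)"
| local_move: "\<lbrakk>type_I_II_move I S J X K (shade_at s p) k T g
        \<or> type_III_move J X K (shade_at s p) k T g;
      wf_tangle (one_two_box_labels P) s m A w; p + k \<le> w;
      wf_tangle (one_two_box_labels P) s w B m\<rbrakk> \<Longrightarrow>
    move scale P Z I S J X K s m (A @ place p T @ B)
      (\<Sum>U\<in>Poly_Mapping.keys g.
        Poly_Mapping.single (A @ place p U @ B) (Poly_Mapping.lookup g U))"
| through_strings: "\<lbrakk>k = 1 \<or> k = 2;
      wf_tangle (one_two_box_labels P) s m A w; p + k \<le> w;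
      wf_tangle (one_two_box_labels P) s w B m\<rbrakk> \<Longrightarrow>
    move scale P Z I S J X K s m (A @ B)
      (Poly_Mapping.single (A @ (p, Box k (Z (shade_at s p) k [])) # B) 1)"
| linearity: "\<lbrakk>wf_tangle (one_two_box_labels P) s m (A @ (p, Box k u) # B) m;
      wf_tangle (one_two_box_labels P) s m (A @ (p, Box k v) # B) m\<rbrakk> \<Longrightarrow>
    move scale P Z I S J X K s m (A @ (p, Box k (scale a u + scale b v)) # B)
      (Poly_Mapping.single (A @ (p, Box k u) # B) a
       + Poly_Mapping.single (A @ (p, Box k v) # B) b)"

text \<open>\<open>reduces \<dots> s m T g\<close>: \<open>T\<close> is reduced to the formal linear combination \<open>g\<close> by finitely many moves,
  each tangle that occurs being reduced further on its own.  The moves are only ever used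
  from left to right.\<close>

inductive reduces ::
  "('k::field \<Rightarrow> 'v \<Rightarrow> 'v::ab_group_add) \<Rightarrow> (nat \<Rightarrow> bool \<Rightarrow> 'v set) \<Rightarrow>
   (bool \<Rightarrow> nat \<Rightarrow> 'v tangle \<Rightarrow> 'v) \<Rightarrow>
   (bool \<Rightarrow> 'i set) \<Rightarrow> ('i \<Rightarrow> 'v) \<Rightarrow> (bool \<Rightarrow> 'j set) \<Rightarrow> ('j \<Rightarrow> 'v) \<Rightarrow> ('i, 'j, 'k) coeffs \<Rightarrow>
   bool \<Rightarrow> nat \<Rightarrow> 'v tangle \<Rightarrow> ('v tangle \<Rightarrow>\<^sub>0 'k) \<Rightarrow> bool"
  for scale P Z I S J X K s m
where
  stop: "reduces scale P Z I S J X K s m T (Poly_Mapping.single T 1)"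
| step: "\<lbrakk>move scale P Z I S J X K s m T g;
      \<And>U. U \<in> Poly_Mapping.keys g \<Longrightarrow> reduces scale P Z I S J X K s m U (h U)\<rbrakk> \<Longrightarrow>
    reduces scale P Z I S J X K s m T
      (\<Sum>U\<in>Poly_Mapping.keys g. Poly_Mapping.map ((*) (Poly_Mapping.lookup g U)) (h U))"

end

theory Submission
  imports Defs
begin

text \<open>
  A crossing is a 2-box with an arbitrary basis label.  Because a pair of parallel strings is
      itself a
  2-box, crossings may be inserted anywhere, and by multiplying with an inserted crossing every
  turned 2-box becomes a combination of upright ones.  So only the shape of a tangle matters.  As
      for
  Hecke algebras, the Yang--Baxter relation shows that a word in the crossings on \<open>n\<close> strings can be
  written with the crossing of the last two strings occurring exactly once; by induction one fixed
  word of crossings dominates all others.  Cups and caps are moved to the far right, where a cap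
  meeting a cup is a partial trace, evaluated by moves I and II.  In this way every tangle with \<open>m\<close>
  bottom and \<open>m\<close> top points reduces to the labellings of one word, which is empty for \<open>m = 0\<close>.

  The argument only uses that the set of good tangles is closed under the moves.  It is applied
  to the tangles that reduce to a given finite set, and to the tangles whose value is the same
  multiple of the empty diagram in two planar algebras with the same coefficients.
\<close>

section \<open>Words of layers\<close>

text \<open>No complexity measure decreases, and none is needed: only finiteness of the set of
  shapes matters, so words may grow and coefficients may be ignored. What is controlled is the use
  of the last string. The Yang--Baxter move is available in one direction only, but it is the useful
  one: two crossings of the last two strings become one. A word therefore splits into two words on
  one string fewer, and the recursion is on the number of strings. Since the moves are one-way,
  equality of tangles is replaced by a preorder on shapes, and every rotation or exchange is needed
  in both directions. Rotating crossings is the delicate point: undoing one quarter turn by a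
  product already yields all other rotations, by bending strings and invariance under a full turn.
  In the comparison of two planar algebras the coordinates of two parallel strings enter, although
  they are not among the given coefficients. They are recovered from them by solving the equations
  for a unit.\<close>

lemma shade_at_simps [simp]:
  "shade_at s 0 = s" "shade_at s (Suc p) = (\<not> shade_at s p)"
  by (auto simp: shade_at_def)

lemma shade_at_add: "shade_at s (p + q) = shade_at (shade_at s p) q"
  by (induction q) auto

lemma wf_append:
  "wf_tangle L s m (A @ B) n \<longleftrightarrow> (\<exists>w. wf_tangle L s m A w \<and> wf_tangle L s w B n)"
proof (induction A arbitrary: m)
  case (Cons a A)
  show ?case by (cases a) (simp add: Cons)
qed simp

lemma wf_unique: "wf_tangle L s m T n \<Longrightarrow> wf_tangle L' s' m T n' \<Longrightarrow> n = n'"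
  by (induction T arbitrary: m) auto

lemma wf_mono:
  assumes "\<And>k t. L k t \<subseteq> L' k t"
  shows "wf_tangle L s m T n \<Longrightarrow> wf_tangle L' s m T n"
proof (induction T arbitrary: m)
  case (Cons a T)
  then show ?case using assms by (cases a) (auto split: piece.splits)
qed simp

lemma fill_simps [simp]:
  "fill f [] = []" "fill f ((p, c) # T) = (p, map_piece f c) # fill f T"
  "fill f (A @ B) = fill f A @ fill f B" "length (fill f T) = length T"
  by (auto simp: fill_def)

lemma place_simps [simp]:
  "place q [] = []" "place q ((p, c) # T) = (q + p, c) # place q T"
  "place q (A @ B) = place q A @ place q B" "place 0 T = T"
  by (auto simp: place_def)

lemma fill_eq_Nil [simp]: "fill f T = [] \<longleftrightarrow> T = []"
  by (simp add: fill_def)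

lemma fill_eq_append:
  "fill f T = U @ V \<longleftrightarrow> (\<exists>A B. T = A @ B \<and> fill f A = U \<and> fill f B = V)"
  by (auto simp: fill_def map_eq_append_conv)

lemma fill_eq_Cons:
  "fill f T = (p, c) # V \<longleftrightarrow> (\<exists>d B. T = (p, d) # B \<and> map_piece f d = c \<and> fill f B = V)"
  by (auto simp: fill_def map_eq_Cons_conv)

lemma ins_outs_map [simp]: "ins (map_piece f c) = ins c" "outs (map_piece f c) = outs c"
  by (cases c; simp)+

lemma map_piece_eq [simp]:
  "map_piece f c = Cup \<longleftrightarrow> c = Cup" "map_piece f c = Cap \<longleftrightarrow> c = Cap"
  "map_piece f c = Box k v \<longleftrightarrow> (\<exists>u. c = Box k u \<and> f u = v)"
  by (cases c; auto)+

lemma wf_fill: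
  assumes "\<And>k t v. v \<in> L k t \<Longrightarrow> f v \<in> L' k t"
  shows "wf_tangle L s m T n \<Longrightarrow> wf_tangle L' s m (fill f T) n"
proof (induction T arbitrary: m)
  case (Cons a T)
  then show ?case using assms by (cases a) (auto split: piece.splits)
qed simp

text \<open>\<open>ins c\<close> and \<open>outs c\<close> differ by an even number, so a box that
  slides past another piece keeps its shading, and its label stays admissible.\<close>

lemma shade_at_ins_outs: "p + outs c \<le> q \<Longrightarrow> shade_at s (q - outs c + ins c) = shade_at s q"
  by (cases c) (auto simp: shade_at_def)

definition basis_labels ::
  "(bool \<Rightarrow> 'i set) \<Rightarrow> ('i \<Rightarrow> 'l) \<Rightarrow> (bool \<Rightarrow> 'j set) \<Rightarrow> ('j \<Rightarrow> 'l) \<Rightarrow> nat \<Rightarrow> bool \<Rightarrow> 'l set" where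
  "basis_labels I S J X k t = (if k = 1 then S ` I t else if k = 2 then X ` J t else {})"

lemma basis_labels_simps [simp]:
  "basis_labels I S J X (Suc 0) t = S ` I t" "basis_labels I S J X 2 t = X ` J t"
  by (simp_all add: basis_labels_def)

lemma keys_sum_single: "Poly_Mapping.keys (\<Sum>i\<in>A. Poly_Mapping.single (u i) (a i)) \<subseteq> u ` A"
  using keys_sum[of "\<lambda>i. Poly_Mapping.single (u i) (a i)" A] by (fastforce split: if_splits)

section \<open>Words in crossings and dots, and standard shapes\<close>

abbreviation cross :: "nat \<Rightarrow> nat \<times> unit piece" where "cross p \<equiv> (p, Box 2 ())"
abbreviation dot :: "nat \<Rightarrow> nat \<times> unit piece" where "dot p \<equiv> (p, Box (Suc 0) ())"

definition letter :: "nat \<Rightarrow> nat \<times> unit piece \<Rightarrow> bool" where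
  "letter n l \<longleftrightarrow> (\<exists>p. l = cross p \<and> p + 2 \<le> n \<or> l = dot p \<and> p + 1 \<le> n)"

definition words :: "nat \<Rightarrow> unit tangle set" where
  "words n = {W. \<forall>l\<in>set W. letter n l}"

lemma letter_simps [simp]:
  "letter n (cross p) \<longleftrightarrow> p + 2 \<le> n" "letter n (dot p) \<longleftrightarrow> p + 1 \<le> n"
  by (auto simp: letter_def)

lemma words_simps [simp]:
  "[] \<in> words n"
  "l # W \<in> words n \<longleftrightarrow> letter n l \<and> W \<in> words n"
  "W @ V \<in> words n \<longleftrightarrow> W \<in> words n \<and> V \<in> words n"
  by (auto simp: words_def)

lemma letterE:
  assumes "letter n l"
  obtains p where "l = cross p" "p + 2 \<le> n" | p where "l = dot p" "p + 1 \<le> n"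
  using assms by (auto simp: letter_def)

lemma words_mono: "W \<in> words n \<Longrightarrow> n \<le> n' \<Longrightarrow> W \<in> words n'"
  by (auto simp: words_def letter_def)

lemma words_0: "words 0 = {[]}"
proof -
  have "W = []" if "W \<in> words 0" for W
    using that by (cases W) (auto simp: letter_def)
  then show ?thesis by auto
qed

lemma Suc_Suc_diff_2: "2 \<le> w \<Longrightarrow> Suc (Suc (w - 2)) = w"
  by simp

text \<open>The recursion mirrors the splitting of a word at a single crossing of the last two
  strings; there are \<open>2^n - 1\<close> crossings. One string leaves no room for a crossing, so
  it is bent into a zigzag, and a crossing of two of its strands absorbs all dots.\<close>

fun normal_word :: "nat \<Rightarrow> unit tangle" where
  "normal_word 0 = []"
| "normal_word (Suc 0) = [(1, Cup), cross 0, (0, Cap)]"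
| "normal_word (Suc (Suc n)) = normal_word (Suc n) @ cross n # normal_word (Suc n)"

text \<open>The cups stand side by side, each added at the far right, so that a word on the strings
  already present slides past the next one.\<close>

fun cups :: "nat \<Rightarrow> nat \<Rightarrow> unit tangle" where
  "cups m 0 = []"
| "cups m (Suc k) = cups m k @ [(m + 2 * k, Cup)]"

text \<open>The recursion starts from the other end than in \<open>cups\<close>: the last layer is
  the cap at \<open>n\<close>, the one met by a cup that is added at the far right.\<close>

fun caps :: "nat \<Rightarrow> nat \<Rightarrow> unit tangle" where
  "caps n 0 = []"
| "caps n (Suc k) = caps (n + 2) k @ [(n, Cap)]"

lemma caps_ge: "l \<in> set (caps n k) \<Longrightarrow> n \<le> fst l"
  by (induction k arbitrary: n) fastforce+

text \<open>Truncated subtraction leaves at least one of the outer parts empty: there are cups only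
  if strings are gained and caps only if strings are lost. The word lives on the larger number of
  strings.\<close>

definition standard :: "nat \<Rightarrow> nat \<Rightarrow> unit tangle set" where
  "standard m n = {cups m ((n - m) div 2) @ W @ caps n ((m - n) div 2) |W. W \<in> words (max m n)}"

lemma standard_grow: "W \<in> words (m + 2 * k) \<Longrightarrow> cups m k @ W \<in> standard m (m + 2 * k)"
  unfolding standard_def by (auto intro!: exI[of _ W])

lemma standard_shrink: "W \<in> words (n + 2 * k) \<Longrightarrow> W @ caps n k \<in> standard (n + 2 * k) n"
  unfolding standard_def by (auto intro!: exI[of _ W])

text \<open>\<open>Suc k\<close> in the second alternative guarantees that there is a last
  cap.\<close>

lemma standard_cases:
  assumes "V \<in> standard m n" "even (m + n)"
  obtains k W where "n = m + 2 * k" "V = cups m k @ W" "W \<in> words n"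
  | k W where "m = n + 2 * Suc k" "V = W @ caps n (Suc k)" "W \<in> words m"
proof (cases "m \<le> n")
  case True
  with assms(2) obtain k where "n = m + 2 * k"
    by (metis add_diff_cancel_left' even_diff_nat evenE le_add_diff_inverse add.commute)
  with assms(1) that(1) show ?thesis by (auto simp: standard_def)
next
  case False
  with assms(2) obtain k where k: "m - n = 2 * k" by (metis even_diff_nat evenE)
  with False obtain k' where "k = Suc k'" by (cases k) auto
  with False k have m: "m = n + 2 * Suc k'" by simp
  from assms(1) obtain W where "V = W @ caps n (Suc k')" "W \<in> words m"
    unfolding standard_def m by auto
  with m that(2) show ?thesis by blast
qed

section \<open>Reducing arbitrary tangles to normal words\<close>

text \<open>Closure is backwards: a tangle is good once all tangles replacing it are good, whatever
  their coefficients. Only isotopy, being reversible, gives an equivalence.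
  \<open>good_insert\<close> combines viewing two through strings as a 2-box with expanding that
  2-box in the basis. Labels are basis elements, so that a shape has finitely many
  labellings.\<close>

locale reduction =
  fixes I :: "bool \<Rightarrow> 'i set" and S :: "'i \<Rightarrow> 'l"
    and J :: "bool \<Rightarrow> 'j set" and X :: "'j \<Rightarrow> 'l"
    and K :: "('i, 'j, 'k::field) coeffs"
    and s :: bool and M :: nat and good :: "'l tangle \<Rightarrow> bool"
  assumes good_isotopy: "\<lbrakk>isotopy_gen u v;
        wf_tangle (basis_labels I S J X) s M (A @ u @ B) M;
        wf_tangle (basis_labels I S J X) s M (A @ v @ B) M\<rbrakk>
      \<Longrightarrow> good (A @ u @ B) = good (A @ v @ B)"
    and good_local: "\<lbrakk>type_I_II_move I S J X K (shade_at s p) k T g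
          \<or> type_III_move J X K (shade_at s p) k T g;
        wf_tangle (basis_labels I S J X) s M A w; p + k \<le> w;
        wf_tangle (basis_labels I S J X) s w B M;
        \<And>U. U \<in> Poly_Mapping.keys g \<Longrightarrow> good (A @ place p U @ B)\<rbrakk>
      \<Longrightarrow> good (A @ place p T @ B)"
    and good_insert: "\<lbrakk>wf_tangle (basis_labels I S J X) s M A w; p + 2 \<le> w;
        wf_tangle (basis_labels I S J X) s w B M;
        \<And>j. j \<in> J (shade_at s p) \<Longrightarrow> good (A @ (p, Box 2 (X j)) # B)\<rbrakk>
      \<Longrightarrow> good (A @ B)"
begin

section \<open>A preorder on shapes\<close>

abbreviation wf :: "nat \<Rightarrow> 'l tangle \<Rightarrow> nat \<Rightarrow> bool" where
  "wf \<equiv> wf_tangle (basis_labels I S J X) s"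

definition shape :: "'l tangle \<Rightarrow> unit tangle" where
  "shape = fill (\<lambda>_. ())"

text \<open>Quantifying over the surrounding tangles \<open>A\<close> and \<open>B\<close> builds
  compatibility with contexts into the preorder; quantifying over all labellings makes it blind to
  the labels that a move produces.\<close>

definition sred :: "nat \<Rightarrow> unit tangle \<Rightarrow> unit tangle set \<Rightarrow> bool" where
  "sred m W H \<longleftrightarrow> (\<forall>n A B T. wf M A m \<longrightarrow> wf m T n \<longrightarrow> wf n B M \<longrightarrow> shape T = W \<longrightarrow>
     (\<forall>U. wf m U n \<longrightarrow> shape U \<in> H \<longrightarrow> good (A @ U @ B)) \<longrightarrow> good (A @ T @ B))"

definition rw :: "nat \<Rightarrow> unit tangle \<Rightarrow> unit tangle \<Rightarrow> bool" where
  "rw m W V \<longleftrightarrow> sred m W {V}"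

lemma sredI:
  assumes "\<And>n A B T. \<lbrakk>wf M A m; wf m T n; wf n B M; shape T = W;
     \<And>U. wf m U n \<Longrightarrow> shape U \<in> H \<Longrightarrow> good (A @ U @ B)\<rbrakk> \<Longrightarrow> good (A @ T @ B)"
  shows "sred m W H"
  unfolding sred_def using assms by blast

lemma sredD:
  "\<lbrakk>sred m W H; wf M A m; wf m T n; wf n B M; shape T = W;
     \<And>U. wf m U n \<Longrightarrow> shape U \<in> H \<Longrightarrow> good (A @ U @ B)\<rbrakk> \<Longrightarrow> good (A @ T @ B)"
  unfolding sred_def by blast

lemma rwI:
  assumes "\<And>n A B T. \<lbrakk>wf M A m; wf m T n; wf n B M; shape T = W;
     \<And>U. wf m U n \<Longrightarrow> shape U = V \<Longrightarrow> good (A @ U @ B)\<rbrakk> \<Longrightarrow> good (A @ T @ B)"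
  shows "rw m W V"
  unfolding rw_def by (rule sredI) (simp add: assms)

lemma rwD:
  "\<lbrakk>rw m W V; wf M A m; wf m T n; wf n B M; shape T = W;
     \<And>U. wf m U n \<Longrightarrow> shape U = V \<Longrightarrow> good (A @ U @ B)\<rbrakk> \<Longrightarrow> good (A @ T @ B)"
  unfolding rw_def by (erule sredD) auto

lemma sred_refl: "W \<in> H \<Longrightarrow> sred m W H"
  unfolding sred_def by blast

lemma sred_trans: "sred m W G \<Longrightarrow> (\<And>V. V \<in> G \<Longrightarrow> sred m V H) \<Longrightarrow> sred m W H"
  unfolding sred_def by blast

lemma rw_sred: "rw m W V \<Longrightarrow> sred m V H \<Longrightarrow> sred m W H"
  unfolding rw_def by (erule sred_trans) simp

lemma rw_trans [trans]: "rw m W V \<Longrightarrow> rw m V U \<Longrightarrow> rw m W U"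
  using rw_sred unfolding rw_def by blast

lemma sred_context:
  assumes V: "wf_tangle (\<lambda>_ _. UNIV) s m V w" and "sred w W H"
  shows "sred m (V @ W @ V') ((\<lambda>U. V @ U @ V') ` H)"
proof (rule sredI)
  fix n A B T
  assume A: "wf M A m" and T: "wf m T n" and B: "wf n B M" and sh: "shape T = V @ W @ V'"
    and good: "\<And>U. wf m U n \<Longrightarrow> shape U \<in> (\<lambda>U. V @ U @ V') ` H \<Longrightarrow> good (A @ U @ B)"
  from sh obtain T1 T2 T3 where T': "T = T1 @ T2 @ T3" "shape T1 = V" "shape T2 = W" "shape T3 = V'"
    unfolding shape_def fill_eq_append by blast
  from T T' obtain m1 n1 where wfs: "wf m T1 m1" "wf m1 T2 n1" "wf n1 T3 n"
    by (auto simp: wf_append)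
  have "wf_tangle (\<lambda>_ _. UNIV) s m (shape T1) m1"
    unfolding shape_def by (rule wf_fill[OF _ wfs(1)]) simp
  then have [simp]: "m1 = w" using V T'(2) wf_unique by metis
  have "good ((A @ T1) @ T2 @ (T3 @ B))"
  proof (rule sredD[OF assms(2)])
    show "wf M (A @ T1) w" "wf w T2 n1" "wf n1 (T3 @ B) M" using A B wfs by (auto simp: wf_append)
    fix U assume U: "wf w U n1" "shape U \<in> H"
    then have "good (A @ (T1 @ U @ T3) @ B)"
      using wfs T' by (intro good) (auto simp: wf_append shape_def)
    then show "good ((A @ T1) @ U @ T3 @ B)" by simp
  qed (rule T')
  then show "good (A @ T @ B)" using T'(1) by simp
qed

lemma rw_contextI:
  assumes "wf_tangle (\<lambda>_ _. UNIV) s m V w" and "rw w W U"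
  shows "rw m (V @ W @ V') (V @ U @ V')"
  using sred_context[OF assms(1) assms(2)[unfolded rw_def]] by (simp add: rw_def)

text \<open>The number of strings above the prefix need not be known here: it is read off from the
  labelled tangle, as the inner rewrite is available on any number of strings.\<close>

lemma rw_context:
  assumes "\<And>w. rw w W U"
  shows "rw m (V @ W @ V') (V @ U @ V')"
proof (rule rwI)
  fix n A B T
  assume A: "wf M A m" and T: "wf m T n" and B: "wf n B M" and sh: "shape T = V @ W @ V'"
    and good: "\<And>U'. wf m U' n \<Longrightarrow> shape U' = V @ U @ V' \<Longrightarrow> good (A @ U' @ B)"
  from sh obtain T1 T23 where T1: "T = T1 @ T23" "shape T1 = V"
    unfolding shape_def fill_eq_append by blast
  from T T1 obtain w where "wf m T1 w" by (auto simp: wf_append)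
  then have "wf_tangle (\<lambda>_ _. UNIV) s m (shape T1) w"
    unfolding shape_def by (rule wf_fill[rotated]) simp
  from rw_contextI[OF this[unfolded T1] assms, of V'] show "good (A @ T @ B)"
    by (rule rwD[OF _ A T B sh good])
qed

section \<open>Isotopies and moves on the level of shapes\<close>

lemma rw_isotopy:
  assumes "isotopy_gen u v" "wf M A m" "wf m u n" "wf m v n" "wf n B M"
  shows "good (A @ u @ B) = good (A @ v @ B)"
  using assms by (intro good_isotopy) (auto simp: wf_append)

lemma exchange_wf:
  assumes "p + outs c \<le> q"
  shows "wf m [(p, c), (q, d)] n \<longleftrightarrow> wf m [(q - outs c + ins c, d), (p, c)] n"
  using assms shade_at_ins_outs[of p c q s] by (auto split: piece.splits)

lemma rw_exchange:
  assumes "p + outs c \<le> q"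
  shows "rw m [(p, c), (q, d)] [(q - outs c + ins c, d), (p, c)]"
proof (rule rwI)
  fix n A B T
  assume A: "wf M A m" and T: "wf m T n" and B: "wf n B M" and sh: "shape T = [(p, c), (q, d)]"
    and good: "\<And>U'. wf m U' n \<Longrightarrow> shape U' = [(q - outs c + ins c, d), (p, c)] \<Longrightarrow> good (A @ U' @ B)"
  from sh obtain c' d' where T': "T = [(p, c'), (q, d')]" "map_piece (\<lambda>_. ()) c' = c" "map_piece
      (\<lambda>_. ()) d' = d"
    by (auto simp: shape_def fill_eq_Cons)
  have le: "p + outs c' \<le> q" using assms T' by auto
  have wf: "wf m [(q - outs c' + ins c', d'), (p, c')] n"
    using exchange_wf[OF le] T T' by blast
  have "good (A @ [(q - outs c' + ins c', d'), (p, c')] @ B)"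
    using T' wf by (intro good) (auto simp: shape_def)
  with rw_isotopy[OF exchange[OF le] A T[unfolded T'(1)] wf B] show "good (A @ T @ B)"
    unfolding T'(1) by blast
qed

text \<open>The generator of isotopy read backwards, which a one-sided preorder needs as a separate
  rule. The new position is the one that the generator shifts back to \<open>q\<close>.\<close>

lemma rw_exchange':
  assumes "p + ins c \<le> q"
  shows "rw m [(q, d), (p, c)] [(p, c), (q - ins c + outs c, d)]"
proof (rule rwI)
  let ?q = "q - ins c + outs c"
  fix n A B T
  assume A: "wf M A m" and T: "wf m T n" and B: "wf n B M" and sh: "shape T = [(q, d), (p, c)]"
    and good: "\<And>U'. wf m U' n \<Longrightarrow> shape U' = [(p, c), (?q, d)] \<Longrightarrow> good (A @ U' @ B)"
  from sh obtain c' d' where T': "T = [(q, d'), (p, c')]" "map_piece (\<lambda>_. ()) c' = c" "map_piece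
      (\<lambda>_. ()) d' = d"
    by (auto simp: shape_def fill_eq_Cons)
  have le: "p + outs c' \<le> ?q" using assms T' by auto
  have q: "?q - outs c' + ins c' = q" using assms T' by auto
  have wf: "wf m [(p, c'), (?q, d')] n"
    using exchange_wf[OF le, unfolded q] T T' by blast
  have "good (A @ [(p, c'), (?q, d')] @ B)"
    using T' wf by (intro good) (auto simp: shape_def)
  with rw_isotopy[OF exchange[OF le] A wf _ B, unfolded q] T show "good (A @ T @ B)"
    unfolding T'(1) by blast
qed

lemma rw_zigzag_left: "rw m [(p, Cup), (Suc p, Cap)] []"
proof (rule rwI)
  fix n A B T
  assume A: "wf M A m" and T: "wf m T n" and B: "wf n B M" and sh: "shape T = [(p, Cup), (Suc p,
      Cap)]"
    and good: "\<And>U'. wf m U' n \<Longrightarrow> shape U' = [] \<Longrightarrow> good (A @ U' @ B)"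
  have T': "T = [(p, Cup), (Suc p, Cap)]" using sh by (auto simp: shape_def fill_eq_Cons)
  have wf: "wf m [] n" using T by (simp add: T')
  show "good (A @ T @ B)"
    using rw_isotopy[OF zigzag_left A T[unfolded T'] wf B] good[OF wf] by (simp add: T' shape_def)
qed

lemma rw_zigzag_right: "rw m [(Suc p, Cup), (p, Cap)] []"
proof (rule rwI)
  fix n A B T
  assume A: "wf M A m" and T: "wf m T n" and B: "wf n B M" and sh: "shape T = [(Suc p, Cup), (p,
      Cap)]"
    and good: "\<And>U'. wf m U' n \<Longrightarrow> shape U' = [] \<Longrightarrow> good (A @ U' @ B)"
  have T': "T = [(Suc p, Cup), (p, Cap)]" using sh by (auto simp: shape_def fill_eq_Cons)
  have wf: "wf m [] n" using T by (simp add: T')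
  show "good (A @ T @ B)"
    using rw_isotopy[OF zigzag_right A T[unfolded T'] wf B] good[OF wf] by (simp add: T' shape_def)
qed

text \<open>Creating a zigzag requires a string to bend, hence \<open>p < m\<close>. When a zigzag
  is straightened, its well-formedness already supplies that string.\<close>

lemma rw_zigzag_left':
  assumes "p < m" shows "rw m [] [(p, Cup), (Suc p, Cap)]"
proof (rule rwI)
  let ?U = "[(p, Cup), (Suc p, Cap)]"
  fix n A B T
  assume A: "wf M A m" and T: "wf m T n" and B: "wf n B M" and sh: "shape T = []"
    and good: "\<And>U'. wf m U' n \<Longrightarrow> shape U' = [(p, Cup), (Suc p, Cap)] \<Longrightarrow> good (A @ U' @ B)"
  have T': "T = []" using sh by (auto simp: shape_def)
  have wf: "wf m ?U n" using T assms by (simp add: T')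
  show "good (A @ T @ B)"
    using rw_isotopy[OF zigzag_left A wf T[unfolded T'] B] good[OF wf] by (simp add: T' shape_def)
qed

lemma rw_zigzag_right':
  assumes "p < m" shows "rw m [] [(Suc p, Cup), (p, Cap)]"
proof (rule rwI)
  let ?U = "[(Suc p, Cup), (p, Cap)]"
  fix n A B T
  assume A: "wf M A m" and T: "wf m T n" and B: "wf n B M" and sh: "shape T = []"
    and good: "\<And>U'. wf m U' n \<Longrightarrow> shape U' = [(Suc p, Cup), (p, Cap)] \<Longrightarrow> good (A @ U' @ B)"
  have T': "T = []" using sh by (auto simp: shape_def)
  have wf: "wf m ?U n" using T assms by (simp add: T')
  show "good (A @ T @ B)"
    using rw_isotopy[OF zigzag_right A wf T[unfolded T'] B] good[OF wf] by (simp add: T' shape_def)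
qed

lemma rw_half_turn:
  "rw m [(p + 2, Cup), (p + 3, Cup), cross (p + 2), (p + 1, Cap), (p, Cap)]
        [(p, Cup), (p + 1, Cup), cross (p + 2), (p + 3, Cap), (p + 2, Cap)]"
proof (rule rwI)
  fix n A B T
  assume A: "wf M A m" and T: "wf m T n" and B: "wf n B M"
    and sh: "shape T = [(p + 2, Cup), (p + 3, Cup), cross (p + 2), (p + 1, Cap), (p, Cap)]"
    and good: "\<And>U'. wf m U' n \<Longrightarrow> shape U' = [(p, Cup), (p + 1, Cup), cross (p + 2), (p + 3, Cap),
        (p + 2, Cap)] \<Longrightarrow> good (A @ U' @ B)"
  from sh obtain v where T': "T = [(p + 2, Cup), (p + 3, Cup), (p + 2, Box 2 v), (p + 1, Cap), (p,
      Cap)]"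
    by (auto simp: shape_def fill_eq_Cons)
  let ?U = "[(p, Cup), (p + 1, Cup), (p + 2, Box 2 v), (p + 3, Cap), (p + 2, Cap)]"
  have gen: "isotopy_gen ?U T"
    using half_turn[of p 2 v] by (simp add: T' nested_cups_def nested_caps_def eval_nat_numeral)
  have wf: "wf m ?U n" using T by (auto simp: T')
  show "good (A @ T @ B)"
    using rw_isotopy[OF gen A wf T B] good[OF wf] by (simp add: shape_def)
qed

lemma rw_insert:
  assumes "p + 2 \<le> m" shows "rw m [] [cross p]"
proof (rule rwI)
  fix n A B T
  assume A: "wf M A m" and T: "wf m T n" and B: "wf n B M" and sh: "shape T = []"
    and good: "\<And>U'. wf m U' n \<Longrightarrow> shape U' = [cross p] \<Longrightarrow> good (A @ U' @ B)"
  have T': "T = []" "n = m" using sh T by (auto simp: shape_def)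
  have "good (A @ B)"
  proof (rule good_insert[OF A assms])
    show "wf m B M" using B T' by simp
    fix j assume "j \<in> J (shade_at s p)"
    then show "good (A @ (p, Box 2 (X j)) # B)"
      using assms T' good[of "[(p, Box 2 (X j))]"] by (simp add: shape_def)
  qed
  then show "good (A @ T @ B)" using T' by simp
qed

lemma rw_type_II: "rw m [cross p, cross p] [cross p]"
proof (rule rwI)
  fix n A B T
  assume A: "wf M A m" and T: "wf m T n" and B: "wf n B M" and sh: "shape T = [cross p, cross p]"
    and good: "\<And>U'. wf m U' n \<Longrightarrow> shape U' = [cross p] \<Longrightarrow> good (A @ U' @ B)"
  from sh obtain u v where "T = [(p, Box 2 u), (p, Box 2 v)]"
    by (auto simp: shape_def fill_eq_Cons)
  with T obtain j k where T': "T = [(p, Box 2 (X j)), (p, Box 2 (X k))]" and n: "n = m" "p + 2 \<le> m"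
    and jk: "j \<in> J (shade_at s p)" "k \<in> J (shade_at s p)"
    by auto
  from type_II[where S = S and X = X and I = I and K = K and J = J and r = 0 and r' = 0, OF jk(2)
      _ jk(1)]
  have "type_I_II_move I S J X K (shade_at s p) 2 (stack (box 2 (X k)) (box 2 (X j)))
      (\<Sum>l\<in>J (shade_at s p). Poly_Mapping.single (box 2 (X l)) (coeff_II K (shade_at s p) k 0
          (shade_at s p) j 0 l))"
    by (simp add: turn_def)
  then have "good (A @ place p (stack (box 2 (X k)) (box 2 (X j))) @ B)"
  proof (rule good_local[OF disjI1 A])
    show "p + 2 \<le> m" "wf m B M" using n B by auto
    fix U assume "U \<in> Poly_Mapping.keys (\<Sum>l\<in>J (shade_at s p). Poly_Mapping.single (box 2 (X l))
        (coeff_II K (shade_at s p) k 0 (shade_at s p) j 0 l))"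
    then obtain l where "l \<in> J (shade_at s p)" "U = box 2 (X l)" using keys_sum_single by fastforce
    then show "good (A @ place p U @ B)"
      using n by (intro good) (auto simp: shape_def box_def)
  qed
  then show "good (A @ T @ B)" by (simp add: T' stack_def box_def)
qed

text \<open>Type II with the lower factor turned by one step. This is the only move applied to a
  turned 2-box; all other rotations of crossings are reduced to it.\<close>

lemma rw_type_II_turned:
  "rw m [(p, Cup), cross (Suc p), (p + 2, Cap), cross p] [cross p]"
proof (rule rwI)
  fix n A B T
  assume A: "wf M A m" and T: "wf m T n" and B: "wf n B M"
    and sh: "shape T = [(p, Cup), cross (Suc p), (p + 2, Cap), cross p]"
    and good: "\<And>U'. wf m U' n \<Longrightarrow> shape U' = [cross p] \<Longrightarrow> good (A @ U' @ B)"
  from sh obtain u v where "T = [(p, Cup), (Suc p, Box 2 u), (p + 2, Cap), (p, Box 2 v)]"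
    by (auto simp: shape_def fill_eq_Cons)
  with T obtain j k where T': "T = [(p, Cup), (Suc p, Box 2 (X j)), (p + 2, Cap), (p, Box 2 (X k))]"
    and n: "n = m" "p + 2 \<le> m"
    and jk: "j \<in> J (\<not> shade_at s p)" "k \<in> J (shade_at s p)"
    by auto
  from type_II[where S = S and X = X and I = I and K = K and J = J and r = 0 and r' = 1, OF jk(2)
      _ jk(1)]
  have "type_I_II_move I S J X K (shade_at s p) 2 (stack (box 2 (X k)) (turn 2 1 (box 2 (X j))))
      (\<Sum>l\<in>J (shade_at s p). Poly_Mapping.single (box 2 (X l)) (coeff_II K (shade_at s p) k 0 (\<not>
          shade_at s p) j 1 l))"
    by (simp add: turn_def)
  then have "good (A @ place p (stack (box 2 (X k)) (turn 2 1 (box 2 (X j)))) @ B)"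
  proof (rule good_local[OF disjI1 A])
    show "p + 2 \<le> m" "wf m B M" using n B by auto
    fix U assume "U \<in> Poly_Mapping.keys (\<Sum>l\<in>J (shade_at s p). Poly_Mapping.single (box 2 (X l))
        (coeff_II K (shade_at s p) k 0 (\<not> shade_at s p) j 1 l))"
    then obtain l where "l \<in> J (shade_at s p)" "U = box 2 (X l)" using keys_sum_single by fastforce
    then show "good (A @ place p U @ B)"
      using n by (intro good) (auto simp: shape_def box_def)
  qed
  then show "good (A @ T @ B)" by (simp add: T' stack_def box_def turn_def)
qed

lemma rw_type_I: "rw m [(Suc p, Cup), cross p, (Suc p, Cap)] [dot p]"
proof (rule rwI)
  fix n A B T
  assume A: "wf M A m" and T: "wf m T n" and B: "wf n B M"
    and sh: "shape T = [(Suc p, Cup), cross p, (Suc p, Cap)]"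
    and good: "\<And>U'. wf m U' n \<Longrightarrow> shape U' = [dot p] \<Longrightarrow> good (A @ U' @ B)"
  from sh obtain u where "T = [(Suc p, Cup), (p, Box 2 u), (Suc p, Cap)]"
    by (auto simp: shape_def fill_eq_Cons)
  with T obtain j where T': "T = [(Suc p, Cup), (p, Box 2 (X j)), (Suc p, Cap)]"
    and n: "n = m" "p + 1 \<le> m" and j: "j \<in> J (shade_at s p)"
    by auto
  from type_I[where S = S and X = X and I = I and K = K and J = J and r = 0, OF j]
  have "type_I_II_move I S J X K (shade_at s p) 1 (close_right 2 (box 2 (X j)))
      (\<Sum>l\<in>I (shade_at s p). Poly_Mapping.single (box 1 (S l)) (coeff_I K (shade_at s p) j 0 l))"
    by (simp add: turn_def)
  then have "good (A @ place p (close_right 2 (box 2 (X j))) @ B)"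
  proof (rule good_local[OF disjI1 A])
    show "p + 1 \<le> m" "wf m B M" using n B by auto
    fix U assume "U \<in> Poly_Mapping.keys (\<Sum>l\<in>I (shade_at s p). Poly_Mapping.single (box 1 (S l))
        (coeff_I K (shade_at s p) j 0 l))"
    then obtain l where "l \<in> I (shade_at s p)" "U = box 1 (S l)" using keys_sum_single by fastforce
    then show "good (A @ place p U @ B)"
      using n by (intro good) (auto simp: shape_def box_def)
  qed
  then show "good (A @ T @ B)" by (simp add: T' close_right_def box_def)
qed

text \<open>The half turn of a 1-box closed on its right, that is, a 1-box closed on its left. This
  is the form in which a circle with a dot appears in \<open>rw_circle\<close>.\<close>

lemma rw_type_I'_turned:
  "rw m [(p, Cup), (p, Cup), dot (Suc p), (Suc p, Cap), (p, Cap)] []"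
proof (rule rwI)
  fix n A B T
  assume A: "wf M A m" and T: "wf m T n" and B: "wf n B M"
    and sh: "shape T = [(p, Cup), (p, Cup), dot (Suc p), (Suc p, Cap), (p, Cap)]"
    and good: "\<And>U'. wf m U' n \<Longrightarrow> shape U' = [] \<Longrightarrow> good (A @ U' @ B)"
  from sh obtain u where "T = [(p, Cup), (p, Cup), (Suc p, Box 1 u), (Suc p, Cap), (p, Cap)]"
    by (auto simp: shape_def fill_eq_Cons)
  with T obtain i where T': "T = [(p, Cup), (p, Cup), (Suc p, Box 1 (S i)), (Suc p, Cap), (p, Cap)]"
    and n: "n = m" "p \<le> m" and i: "i \<in> I (\<not> shade_at s p)"
    by auto
  from type_I'[where S = S and X = X and J = J and K = K and I = I and r = 1, OF i]
  have "type_I_II_move I S J X K (shade_at s p) 0 (close_right 1 (turn 1 1 (box 1 (S i))))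
      (Poly_Mapping.single [] (coeff_I' K (\<not> shade_at s p) i 1))"
    by simp
  then have "good (A @ place p (close_right 1 (turn 1 1 (box 1 (S i)))) @ B)"
  proof (rule good_local[OF disjI1 A])
    show "p + 0 \<le> m" "wf m B M" using n B by auto
    fix U assume "U \<in> Poly_Mapping.keys (Poly_Mapping.single ([] :: 'l tangle) (coeff_I' K (\<not>
        shade_at s p) i 1))"
    then have "U = []" by (auto split: if_splits)
    then show "good (A @ place p U @ B)"
      using n good[of "[]"] by (simp add: shape_def)
  qed
  then show "good (A @ T @ B)" by (simp add: T' close_right_def box_def turn_def)
qed

lemma rw_half_turn_dot:
  "rw m [(Suc p, Cup), dot (Suc p), (p, Cap)] [(p, Cup), dot (Suc p), (Suc p, Cap)]"
proof (rule rwI)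
  fix n A B T
  assume A: "wf M A m" and T: "wf m T n" and B: "wf n B M"
    and sh: "shape T = [(Suc p, Cup), dot (Suc p), (p, Cap)]"
    and good: "\<And>U'. wf m U' n \<Longrightarrow> shape U' = [(p, Cup), dot (Suc p), (Suc p, Cap)] \<Longrightarrow> good (A @ U' @
        B)"
  from sh obtain v where T': "T = [(Suc p, Cup), (Suc p, Box 1 v), (p, Cap)]"
    by (auto simp: shape_def fill_eq_Cons)
  let ?U = "[(p, Cup), (Suc p, Box 1 v), (Suc p, Cap)]"
  have gen: "isotopy_gen ?U T"
    using half_turn[of p 1 v] by (simp add: T' nested_cups_def nested_caps_def)
  have wf: "wf m ?U n" using T by (auto simp: T')
  show "good (A @ T @ B)"
    using rw_isotopy[OF gen A wf T B] good[OF wf] by (simp add: shape_def)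
qed

text \<open>Common core of the two absorptions: \<open>c\<close> selects the leg of the crossing,
  and \<open>r\<close> tells whether the 1-box is upright or half turned, as its shading
  demands.\<close>

lemma absorb_move:
  assumes ij: "i \<in> I s'" "j \<in> J (shade_at s p)" and c: "c < 2" "r < 2"
    and s': "shade_at s' r = shade_at (shade_at s p) c"
    and A: "wf M A m" "p + 2 \<le> m" and B: "wf m B M"
    and good: "\<And>U. wf m U m \<Longrightarrow> shape U = [cross p] \<Longrightarrow> good (A @ U @ B)"
  shows "good (A @ (p, Box 2 (X j)) # place (p + c) (turn 1 r (box 1 (S i))) @ B)"
proof -
  let ?t = "shade_at s p"
  define U where "U = place c (turn 1 r (box 1 (S i)))"
  have place_place: "place p (place c T) = place (p + c) T" for T :: "'l tangle"
    by (auto simp: place_def)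
  from type_II'[where S = S and X = X and K = K and I = I and J = J and U = U, OF ij c s'] U_def
  have "type_I_II_move I S J X K ?t 2 (stack U (box 2 (X j)))
      (\<Sum>l\<in>J ?t. Poly_Mapping.single (box 2 (X l)) (coeff_II' K s' i ?t j c top l))"
    by simp
  then have "good (A @ place p (stack U (box 2 (X j))) @ B)"
  proof (rule good_local[OF disjI1 A B])
    fix U assume "U \<in> Poly_Mapping.keys (\<Sum>l\<in>J ?t. Poly_Mapping.single (box 2 (X l)) (coeff_II' K
        s' i ?t j c top l))"
    then obtain l where "l \<in> J ?t" "U = box 2 (X l)" using keys_sum_single by fastforce
    then show "good (A @ place p U @ B)"
      using A by (intro good) (auto simp: shape_def box_def)
  qed
  then show ?thesis by (simp add: U_def place_place stack_def box_def)
qed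

lemma rw_absorb:
  assumes "c < 2"
  shows "rw m [cross p, dot (p + c)] [cross p]"
proof (rule rwI)
  fix n A B T
  assume A: "wf M A m" and T: "wf m T n" and B: "wf n B M"
    and sh: "shape T = [cross p, dot (p + c)]"
    and good: "\<And>U'. wf m U' n \<Longrightarrow> shape U' = [cross p] \<Longrightarrow> good (A @ U' @ B)"
  from sh obtain u v where "T = [(p, Box 2 v), (p + c, Box 1 u)]"
    by (auto simp: shape_def fill_eq_Cons)
  with T obtain i j where T': "T = [(p, Box 2 (X j)), (p + c, Box 1 (S i))]"
    and n: "n = m" "p + 2 \<le> m" and ij: "i \<in> I (shade_at (shade_at s p) c)" "j \<in> J (shade_at s p)"
    by (auto simp: shade_at_add)
  have "good (A @ (p, Box 2 (X j)) # place (p + c) (turn 1 0 (box 1 (S i))) @ B)"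
    using B n good by (intro absorb_move[OF ij assms _ _ A n(2)]) auto
  then show "good (A @ T @ B)" by (simp add: T' box_def turn_def)
qed

lemma rw_absorb_turned:
  assumes "c < 2"
  shows "rw m [cross p, (p + c, Cup), dot (Suc (p + c)), (Suc (p + c), Cap)] [cross p]"
proof (rule rwI)
  fix n A B T
  assume A: "wf M A m" and T: "wf m T n" and B: "wf n B M"
    and sh: "shape T = [cross p, (p + c, Cup), dot (Suc (p + c)), (Suc (p + c), Cap)]"
    and good: "\<And>U'. wf m U' n \<Longrightarrow> shape U' = [cross p] \<Longrightarrow> good (A @ U' @ B)"
  from sh obtain u v where "T = [(p, Box 2 v), (p + c, Cup), (Suc (p + c), Box 1 u), (Suc (p + c),
      Cap)]"
    by (auto simp: shape_def fill_eq_Cons)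
  with T obtain i j where T': "T = [(p, Box 2 (X j)), (p + c, Cup), (Suc (p + c), Box 1 (S i)),
      (Suc (p + c), Cap)]"
    and n: "n = m" "p + 2 \<le> m" and ij: "i \<in> I (\<not> shade_at (shade_at s p) c)" "j \<in> J (shade_at s p)"
    by (auto simp: shade_at_add)
  have "good (A @ (p, Box 2 (X j)) # place (p + c) (turn 1 1 (box 1 (S i))) @ B)"
    using B n good by (intro absorb_move[OF ij assms _ _ A n(2)]) auto
  then show "good (A @ T @ B)" by (simp add: T' box_def turn_def)
qed

text \<open>Two crossings of the right-hand pair of strings become one; this is the direction that
  lowers the use of the last string.\<close>

lemma rw_type_III:
  "rw m [cross (Suc p), cross p, cross (Suc p)] [cross p, cross (Suc p), cross p]"
proof (rule rwI)
  fix n A B T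
  assume A: "wf M A m" and T: "wf m T n" and B: "wf n B M"
    and sh: "shape T = [cross (Suc p), cross p, cross (Suc p)]"
    and good: "\<And>U'. wf m U' n \<Longrightarrow> shape U' = [cross p, cross (Suc p), cross p] \<Longrightarrow> good (A @ U' @ B)"
  let ?t = "shade_at s p"
  from sh obtain u v w where "T = [(Suc p, Box 2 u), (p, Box 2 v), (Suc p, Box 2 w)]"
    by (auto simp: shape_def fill_eq_Cons)
  with T obtain i j k where T': "T = [(Suc p, Box 2 (X k)), (p, Box 2 (X j)), (Suc p, Box 2 (X i))]"
    and n: "n = m" "p + 3 \<le> m" and ijk: "i \<in> J (\<not> ?t)" "j \<in> J ?t" "k \<in> J (\<not> ?t)"
    by auto
  let ?T = "stack (place 1 (box 2 (X i))) (stack (box 2 (X j)) (place 1 (box 2 (X k))))"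
  let ?g = "\<Sum>i'\<in>J ?t. \<Sum>j'\<in>J (\<not> ?t). \<Sum>k'\<in>J ?t.
        Poly_Mapping.single
          (stack (box 2 (X k')) (stack (place 1 (box 2 (X j'))) (box 2 (X i'))))
          (coeff_III K ?t i j k i' j' k')"
  have "type_III_move J X K ?t 3 ?T ?g" by (rule type_III[OF ijk])
  then have "good (A @ place p ?T @ B)"
  proof (rule good_local[OF disjI2 A])
    show "p + 3 \<le> m" "wf m B M" using n B by auto
    fix U assume "U \<in> Poly_Mapping.keys ?g"
    then obtain i' where i': "i' \<in> J ?t" and "U \<in> Poly_Mapping.keys (\<Sum>j'\<in>J (\<not> ?t). \<Sum>k'\<in>J ?t.
        Poly_Mapping.single
          (stack (box 2 (X k')) (stack (place 1 (box 2 (X j'))) (box 2 (X i'))))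
          (coeff_III K ?t i j k i' j' k'))"
      using keys_sum by fastforce
    then obtain j' where j': "j' \<in> J (\<not> ?t)" and "U \<in> Poly_Mapping.keys (\<Sum>k'\<in>J ?t.
        Poly_Mapping.single
          (stack (box 2 (X k')) (stack (place 1 (box 2 (X j'))) (box 2 (X i'))))
          (coeff_III K ?t i j k i' j' k'))"
      using keys_sum by fastforce
    then obtain k' where "k' \<in> J ?t" "U = stack (box 2 (X k')) (stack (place 1 (box 2 (X j')))
        (box 2 (X i')))"
      using keys_sum_single by fastforce
    with i' j' show "good (A @ place p U @ B)"
      using n by (intro good) (auto simp: shape_def box_def stack_def)
  qed
  then show "good (A @ T @ B)" by (simp add: T' stack_def box_def)
qed


lemma rw_Cons: "(\<And>w. rw w W U) \<Longrightarrow> rw m (x # W) (x # U)"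
  using rw_context[of W U m "[x]" "[]"] by simp

lemma rw_prefix: "(\<And>w. rw w W U) \<Longrightarrow> rw m (V @ W) (V @ U)"
  using rw_context[of W U m V "[]"] by simp

lemma rw_suffix: "(\<And>w. rw w W U) \<Longrightarrow> rw m (W @ V) (U @ V)"
  using rw_context[of W U m "[]" V] by simp

lemma rw_refl: "rw m W W"
  unfolding rw_def by (rule sred_refl) simp

lemma rw_swap:
  "p + outs c \<le> q \<Longrightarrow> q' = q - outs c + ins c \<Longrightarrow> rw m ((p, c) # (q, d) # V) ((q', d) # (p, c) # V)"
  using rw_suffix[OF rw_exchange[of p c q], of m d V] by simp

lemma rw_swap':
  "p + ins c \<le> q \<Longrightarrow> q' = q - ins c + outs c \<Longrightarrow> rw m ((q, d) # (p, c) # V) ((p, c) # (q', d) # V)"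
  using rw_suffix[OF rw_exchange'[of p c q], of m d V] by simp

lemma rw_straighten:
  "q = Suc p \<Longrightarrow> rw m ((p, Cup) # (q, Cap) # V) V"
  "q = Suc p \<Longrightarrow> rw m ((q, Cup) # (p, Cap) # V) V"
  using rw_suffix[OF rw_zigzag_left, of m p V] rw_suffix[OF rw_zigzag_right, of m p V] by simp_all

text \<open>If \<open>W\<close> does not fit on \<open>m\<close> strings, nothing is claimed. Its
  positions may thus be assumed in range, as insertions and new zigzags require.\<close>

lemma rw_wfI:
  assumes "\<And>n. wf_tangle (\<lambda>_ _. UNIV) s m W n \<Longrightarrow> rw m W V"
  shows "rw m W V"
proof (rule rwI)
  fix n A B T
  assume *: "wf M A m" "wf m T n" "wf n B M" "shape T = W"
    and good: "\<And>U. wf m U n \<Longrightarrow> shape U = V \<Longrightarrow> good (A @ U @ B)"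
  have "wf_tangle (\<lambda>_ _. UNIV) s m (shape T) n"
    unfolding shape_def by (rule wf_fill[OF _ *(2)]) simp
  with * have "rw m W V" by (intro assms) simp
  then show "good (A @ T @ B)" by (rule rwD[OF _ * good])
qed

lemma rw_insertI:
  assumes "wf_tangle (\<lambda>_ _. UNIV) s m V w" "p + 2 \<le> w"
  shows "rw m (V @ V') (V @ cross p # V')"
  using rw_contextI[OF assms(1) rw_insert[OF assms(2)], of V'] by simp

lemma rw_zigzagI:
  assumes "wf_tangle (\<lambda>_ _. UNIV) s m V w" "p < w"
  shows "rw m (V @ V') (V @ (p, Cup) # (Suc p, Cap) # V')"
    "rw m (V @ V') (V @ (Suc p, Cup) # (p, Cap) # V')"
  using rw_contextI[OF assms(1) rw_zigzag_left'[OF assms(2)], of V']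
    rw_contextI[OF assms(1) rw_zigzag_right'[OF assms(2)], of V'] by simp_all

section \<open>Rotating crossings\<close>

abbreviation turn_left :: "nat \<Rightarrow> unit tangle" where
  "turn_left p \<equiv> [(p, Cup), cross (Suc p), (Suc (Suc p), Cap)]"

abbreviation turn_right :: "nat \<Rightarrow> unit tangle" where
  "turn_right p \<equiv> [(Suc (Suc p), Cup), cross (Suc p), (p, Cap)]"

text \<open>An upright crossing inserted above the turned one forms with it a product of 2-boxes,
  and type II expands the product in upright crossings.\<close>

lemma rw_unturn_left: "rw m (turn_left p) [cross p]"
proof (rule rw_wfI)
  fix n assume "wf_tangle (\<lambda>_ _. UNIV) s m (turn_left p) n"
  then have "rw m (turn_left p) (turn_left p @ [cross p])"
    using rw_insertI[of m "turn_left p" m p "[]"] by simp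
  also have "rw m (turn_left p @ [cross p]) [cross p]"
    using rw_type_II_turned[of m p] by simp
  finally show "rw m (turn_left p) [cross p]" .
qed

text \<open>By isotopy a crossing is the right turn of its own left turn, and the inner left turn is
  undone by \<open>rw_unturn_left\<close>. The label changes in the process, which shapes do not
  see.\<close>

lemma rw_turn_right: "rw m [cross p] (turn_right p)"
proof (rule rw_wfI)
  let ?p1 = "Suc p" and ?p2 = "Suc (Suc p)" and ?p3 = "Suc (Suc (Suc p))" and ?p4 = "Suc (Suc (Suc
      (Suc p)))"
  fix n assume wf: "wf_tangle (\<lambda>_ _. UNIV) s m [cross p] n"
  have "rw m [cross p] [(?p1, Cup), (p, Cap), cross p]"
    using wf rw_zigzagI(2)[of m "[]" m p] by simp
  also have "rw m [(?p1, Cup), (p, Cap), cross p] [(?p1, Cup), cross ?p2, (p, Cap)]"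
    by (intro rw_Cons rw_swap) auto
  also have "rw m [(?p1, Cup), cross ?p2, (p, Cap)] [(?p1, Cup), cross ?p2, (?p4, Cup), (?p3,
      Cap), (p, Cap)]"
    using wf rw_zigzagI(2)[of m "[(?p1, Cup), cross ?p2]" "m + 2" ?p3 "[(p, Cap)]"] by simp
  also have "rw m [(?p1, Cup), cross ?p2, (?p4, Cup), (?p3, Cap), (p, Cap)]
      [(?p1, Cup), (?p4, Cup), cross ?p2, (?p3, Cap), (p, Cap)]"
    by (intro rw_Cons rw_swap) auto
  also have "rw m [(?p1, Cup), (?p4, Cup), cross ?p2, (?p3, Cap), (p, Cap)]
      [(?p2, Cup), (?p1, Cup), cross ?p2, (?p3, Cap), (p, Cap)]"
    by (intro rw_swap) auto
  also have "rw m [(?p2, Cup), (?p1, Cup), cross ?p2, (?p3, Cap), (p, Cap)] (turn_right p)"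
    using rw_context[OF rw_unturn_left, of m "[(?p2, Cup)]" ?p1 "[(p, Cap)]"] by simp
  finally show "rw m [cross p] (turn_right p)" .
qed

text \<open>Turning the inner crossing once more gives a half turn to the right. Full-turn
  invariance identifies it with a half turn to the left, that is, with two left turns, and these can
  be undone.\<close>

lemma rw_unturn_right: "rw m (turn_right p) [cross p]"
proof -
  let ?p1 = "Suc p" and ?p2 = "Suc (Suc p)" and ?p3 = "Suc (Suc (Suc p))"
  have "rw m (turn_right p) [(?p2, Cup), (?p3, Cup), cross ?p2, (?p1, Cap), (p, Cap)]"
    using rw_context[OF rw_turn_right, of m "[(?p2, Cup)]" ?p1 "[(p, Cap)]"] by simp
  also have "rw m [(?p2, Cup), (?p3, Cup), cross ?p2, (?p1, Cap), (p, Cap)]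
      [(p, Cup), (?p1, Cup), cross ?p2, (?p3, Cap), (?p2, Cap)]"
    using rw_half_turn[of m p] by (simp add: eval_nat_numeral)
  also have "rw m [(p, Cup), (?p1, Cup), cross ?p2, (?p3, Cap), (?p2, Cap)] (turn_left p)"
    using rw_context[OF rw_unturn_left, of m "[(p, Cup)]" ?p1 "[(?p2, Cap)]"] by simp
  also have "rw m (turn_left p) [cross p]"
    by (rule rw_unturn_left)
  finally show ?thesis .
qed

text \<open>The mirror image of \<open>rw_turn_right\<close>, which becomes available with
  \<open>rw_unturn_right\<close>.\<close>

lemma rw_turn_left: "rw m [cross p] (turn_left p)"
proof (rule rw_wfI)
  let ?p1 = "Suc p" and ?p2 = "Suc (Suc p)" and ?p3 = "Suc (Suc (Suc p))"
  fix n assume wf: "wf_tangle (\<lambda>_ _. UNIV) s m [cross p] n"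
  have "rw m [cross p] [(?p1, Cup), (?p2, Cap), cross p]"
    using wf rw_zigzagI(1)[of m "[]" m ?p1] by simp
  also have "rw m [(?p1, Cup), (?p2, Cap), cross p] [(?p1, Cup), cross p, (?p2, Cap)]"
    by (intro rw_Cons rw_swap') auto
  also have "rw m [(?p1, Cup), cross p, (?p2, Cap)] [(?p1, Cup), cross p, (p, Cup), (?p1, Cap),
      (?p2, Cap)]"
    using wf rw_zigzagI(1)[of m "[(?p1, Cup), cross p]" "m + 2" p "[(?p2, Cap)]"] by simp
  also have "rw m [(?p1, Cup), cross p, (p, Cup), (?p1, Cap), (?p2, Cap)]
      [(?p1, Cup), (p, Cup), cross ?p2, (?p1, Cap), (?p2, Cap)]"
    by (intro rw_Cons rw_swap') auto
  also have "rw m [(?p1, Cup), (p, Cup), cross ?p2, (?p1, Cap), (?p2, Cap)]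
      [(p, Cup), (?p3, Cup), cross ?p2, (?p1, Cap), (?p2, Cap)]"
    by (intro rw_swap') auto
  also have "rw m [(p, Cup), (?p3, Cup), cross ?p2, (?p1, Cap), (?p2, Cap)] (turn_left p)"
    using rw_context[OF rw_unturn_right, of m "[(p, Cup)]" ?p1 "[(?p2, Cap)]"] by simp
  finally show "rw m [cross p] (turn_left p)" .
qed

text \<open>After an exchange, a cap followed by a cup is a turned pair of parallel strings;
  inserting a crossing there makes it a turned crossing.\<close>

lemma rw_cap_cup: "rw m [(p, Cap), (p, Cup)] [cross p]"
proof (rule rw_wfI)
  let ?p1 = "Suc p" and ?p2 = "Suc (Suc p)"
  fix n assume wf: "wf_tangle (\<lambda>_ _. UNIV) s m [(p, Cap), (p, Cup)] n"
  have "rw m [(p, Cap), (p, Cup)] [(?p2, Cup), (p, Cap)]"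
    by (intro rw_swap) auto
  also have "rw m [(?p2, Cup), (p, Cap)] (turn_right p)"
    using wf rw_insertI[of m "[(?p2, Cup)]" "m + 2" ?p1 "[(p, Cap)]"] by simp
  also have "rw m (turn_right p) [cross p]"
    by (rule rw_unturn_right)
  finally show "rw m [(p, Cap), (p, Cup)] [cross p]" .
qed

text \<open>Turned by a quarter, the crossing of a string with one leg of a cup becomes its crossing
  with the other leg.\<close>

lemma rw_bend_left: "rw m [(Suc p, Cup), cross p] [(p, Cup), cross (Suc p)]"
proof -
  let ?p1 = "Suc p" and ?p2 = "Suc (Suc p)" and ?p3 = "Suc (Suc (Suc p))"
  have "rw m [(?p1, Cup), cross p] [(?p1, Cup), (p, Cup), cross ?p1, (?p2, Cap)]"
    by (intro rw_Cons rw_turn_left)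
  also have "rw m [(?p1, Cup), (p, Cup), cross ?p1, (?p2, Cap)] [(p, Cup), (?p3, Cup), cross ?p1,
      (?p2, Cap)]"
    by (intro rw_swap') auto
  also have "rw m [(p, Cup), (?p3, Cup), cross ?p1, (?p2, Cap)] [(p, Cup), cross ?p1, (?p3, Cup),
      (?p2, Cap)]"
    by (intro rw_Cons rw_swap') auto
  also have "rw m [(p, Cup), cross ?p1, (?p3, Cup), (?p2, Cap)] [(p, Cup), cross ?p1]"
    by (intro rw_Cons rw_straighten) auto
  finally show ?thesis .
qed

lemma rw_bend_right: "rw m [(p, Cup), cross (Suc p)] [(Suc p, Cup), cross p]"
proof -
  let ?p1 = "Suc p" and ?p2 = "Suc (Suc p)" and ?p3 = "Suc (Suc (Suc p))"
  have "rw m [(p, Cup), cross ?p1] [(p, Cup), (?p3, Cup), cross ?p2, (?p1, Cap)]"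
    by (intro rw_Cons rw_turn_right)
  also have "rw m [(p, Cup), (?p3, Cup), cross ?p2, (?p1, Cap)] [(?p1, Cup), (p, Cup), cross ?p2,
      (?p1, Cap)]"
    by (intro rw_swap) auto
  also have "rw m [(?p1, Cup), (p, Cup), cross ?p2, (?p1, Cap)] [(?p1, Cup), cross p, (p, Cup),
      (?p1, Cap)]"
    by (intro rw_Cons rw_swap) auto
  also have "rw m [(?p1, Cup), cross p, (p, Cup), (?p1, Cap)] [(?p1, Cup), cross p]"
    by (intro rw_Cons rw_straighten) auto
  finally show ?thesis .
qed

text \<open>Carried to the other leg of the cup, the first crossing acts on the same two strings as
  the second. The two are multiplied, and the result is carried back.\<close>

lemma rw_cup_cross_cross: "rw m [(Suc p, Cup), cross p, cross (Suc p)] [(Suc p, Cup), cross p]"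
proof -
  have "rw m [(Suc p, Cup), cross p, cross (Suc p)] [(p, Cup), cross (Suc p), cross (Suc p)]"
    using rw_suffix[OF rw_bend_left, of m p "[cross (Suc p)]"] by simp
  also have "rw m [(p, Cup), cross (Suc p), cross (Suc p)] [(p, Cup), cross (Suc p)]"
    by (intro rw_Cons[of "[_, _]"] rw_type_II)
  also note rw_bend_right
  finally show ?thesis .
qed

text \<open>Passing through the cap gives the 1-box a half turn. Equality of the two half turns puts
  it in the form that type II' accepts.\<close>

lemma rw_slide_dot: "rw m [dot (Suc p), (p, Cap)] [(p, Cup), dot (Suc p), (Suc p, Cap), (p, Cap)]"
proof (rule rw_wfI)
  let ?p1 = "Suc p" and ?p2 = "Suc (Suc p)"
  fix n assume wf: "wf_tangle (\<lambda>_ _. UNIV) s m [dot ?p1, (p, Cap)] n"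
  have "rw m [dot ?p1, (p, Cap)] [(?p1, Cup), (?p2, Cap), dot ?p1, (p, Cap)]"
    using wf rw_zigzagI(1)[of m "[]" m ?p1] by simp
  also have "rw m [(?p1, Cup), (?p2, Cap), dot ?p1, (p, Cap)] [(?p1, Cup), dot ?p1, (?p2, Cap),
      (p, Cap)]"
    by (intro rw_Cons rw_swap') auto
  also have "rw m [(?p1, Cup), dot ?p1, (?p2, Cap), (p, Cap)] [(?p1, Cup), dot ?p1, (p, Cap), (p,
      Cap)]"
    by (intro rw_Cons rw_swap') auto
  also have "rw m [(?p1, Cup), dot ?p1, (p, Cap), (p, Cap)] [(p, Cup), dot ?p1, (?p1, Cap), (p,
      Cap)]"
    using rw_suffix[OF rw_half_turn_dot, of m p "[(p, Cap)]"] by simp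
  finally show "rw m [dot ?p1, (p, Cap)] [(p, Cup), dot ?p1, (?p1, Cap), (p, Cap)]" .
qed

text \<open>Two quarter turns put the crossing upside down, so that its lower legs become upper
  ones, bent over by the caps.\<close>

lemma rw_turn_left2:
  "rw m [cross p] [(p, Cup), (Suc p, Cup), cross (Suc (Suc p)), (Suc (Suc (Suc p)), Cap), (Suc
      (Suc p), Cap)]"
proof -
  have "rw m [cross p] (turn_left p)"
    by (rule rw_turn_left)
  also have "rw m \<dots> [(p, Cup), (Suc p, Cup), cross (Suc (Suc p)), (Suc (Suc (Suc p)), Cap), (Suc
      (Suc p), Cap)]"
    using rw_context[OF rw_turn_left, of m "[(p, Cup)]" "Suc p" "[(Suc (Suc p), Cap)]"] by simp
  finally show ?thesis .
qed

lemma rw_unturn_left2: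
  "rw m [(p, Cup), (Suc p, Cup), cross (Suc (Suc p)), (Suc (Suc (Suc p)), Cap), (Suc (Suc p),
      Cap)] [cross p]"
proof -
  have "rw m [(p, Cup), (Suc p, Cup), cross (Suc (Suc p)), (Suc (Suc (Suc p)), Cap), (Suc (Suc p),
      Cap)]
      (turn_left p)"
    using rw_context[OF rw_unturn_left, of m "[(p, Cup)]" "Suc p" "[(Suc (Suc p), Cap)]"] by simp
  also note rw_unturn_left
  finally show ?thesis .
qed

text \<open>In the type II' move \<open>top\<close> is the constant \<open>True\<close>, so 1-boxes may only be attached on top of a
  2-box.  A dot below a crossing gets there by turning the crossing upside down and sliding the dot
  through the cap that appears.\<close>

lemma rw_absorb_below_left: "rw m [dot p, cross p] [cross p]"
proof -
  let ?p1 = "Suc p" and ?p2 = "Suc (Suc p)" and ?p3 = "Suc (Suc (Suc p))" and ?p4 = "Suc (Suc (Suc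
      (Suc p)))"
  have "rw m [dot p, cross p] [dot p, (p, Cup), (?p1, Cup), cross ?p2, (?p3, Cap), (?p2, Cap)]"
    by (intro rw_Cons rw_turn_left2)
  also have "rw m \<dots> [(p, Cup), dot ?p2, (?p1, Cup), cross ?p2, (?p3, Cap), (?p2, Cap)]"
    by (intro rw_swap') auto
  also have "rw m \<dots> [(p, Cup), (?p1, Cup), dot ?p4, cross ?p2, (?p3, Cap), (?p2, Cap)]"
    by (intro rw_Cons rw_swap') auto
  also have "rw m \<dots> [(p, Cup), (?p1, Cup), cross ?p2, dot ?p4, (?p3, Cap), (?p2, Cap)]"
    by (intro rw_Cons rw_swap') auto
  also have "rw m \<dots> [(p, Cup), (?p1, Cup), cross ?p2, (?p3, Cup), dot ?p4, (?p4, Cap), (?p3, Cap),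
      (?p2, Cap)]"
    using rw_context[OF rw_slide_dot, of m "[(p, Cup), (?p1, Cup), cross ?p2]" ?p3 "[(?p2, Cap)]"]
        by simp
  also have "rw m \<dots> [(p, Cup), (?p1, Cup), cross ?p2, (?p3, Cap), (?p2, Cap)]"
    using rw_context[OF rw_absorb_turned[of 1], of m "[(p, Cup), (?p1, Cup)]" ?p2 "[(?p3, Cap),
        (?p2, Cap)]"] by simp
  also note rw_unturn_left2
  finally show ?thesis .
qed

text \<open>A quarter turn makes one of the two closing arcs a partial trace of the crossing, so
  type I leaves a circle with a dot. The dot sits on the right strand, hence it is its half turn
  that type I' removes.\<close>

lemma rw_circle: "rw m [(p, Cup), cross p, (p, Cap)] []"
proof (rule rw_wfI)
  let ?p1 = "Suc p" and ?p2 = "Suc (Suc p)"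
  fix n assume wf: "wf_tangle (\<lambda>_ _. UNIV) s m [(p, Cup), cross p, (p, Cap)] n"
  have "rw m [(p, Cup), cross p, (p, Cap)] [(p, Cup), (?p2, Cup), cross ?p1, (p, Cap), (p, Cap)]"
    using rw_context[OF rw_turn_right, of m "[(p, Cup)]" p "[(p, Cap)]"] by simp
  also have "rw m \<dots> [(p, Cup), (?p2, Cup), cross ?p1, (?p2, Cap), (p, Cap)]"
    by (intro rw_Cons rw_swap) auto
  also have "rw m \<dots> [(p, Cup), dot ?p1, (p, Cap)]"
    using rw_context[OF rw_type_I, of m "[(p, Cup)]" ?p1 "[(p, Cap)]"] by simp
  \<comment> \<open>The extra zigzag provides the second cup and cap that a half-turned 1-box
    carries.\<close>
  also have "rw m \<dots> [(p, Cup), dot ?p1, (?p2, Cup), (?p1, Cap), (p, Cap)]"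
    using wf rw_zigzagI(2)[of m "[(p, Cup), dot ?p1]" "m + 2" ?p1 "[(p, Cap)]"] by simp
  also have "rw m \<dots> [(p, Cup), (?p2, Cup), dot ?p1, (?p1, Cap), (p, Cap)]"
    by (intro rw_Cons rw_swap) auto
  also have "rw m \<dots> [(p, Cup), (p, Cup), dot ?p1, (?p1, Cap), (p, Cap)]"
    by (rule rw_swap) auto
  also note rw_type_I'_turned
  finally show "rw m [(p, Cup), cross p, (p, Cap)] []" .
qed


section \<open>Crossing words: normal form and closures\<close>

lemma wf_words: "W \<in> words n \<Longrightarrow> n \<le> w \<Longrightarrow> wf_tangle (\<lambda>_ _. UNIV) s w W w"
proof (induction W)
  case (Cons l W)
  then show ?case by (auto elim!: letterE simp: Suc_Suc_diff_2)
qed simp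

lemma sred_rw: "rw m W V \<Longrightarrow> V \<in> H \<Longrightarrow> sred m W H"
  by (erule rw_sred) (rule sred_refl)

lemma rw_words_right:
  assumes "W \<in> words n" "n \<le> q"
  shows "rw m (W @ (q, c) # V) ((q, c) # W @ V)"
  using assms
proof (induction W arbitrary: m)
  case (Cons l W)
  have "rw m ((l # W) @ (q, c) # V) (l # (q, c) # W @ V)"
    using Cons by (auto intro!: rw_Cons)
  also have "rw m \<dots> ((q, c) # (l # W) @ V)"
    using Cons.prems by (auto elim!: letterE intro!: rw_swap)
  finally show ?case .
qed (simp add: rw_refl)

lemma rw_words_left:
  assumes "W \<in> words n" "n \<le> q"
  shows "rw m ((q, c) # W @ V) (W @ (q, c) # V)"
  using assms
proof (induction W arbitrary: m)
  case (Cons l W)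
  have "rw m ((q, c) # (l # W) @ V) (l # (q, c) # W @ V)"
    using Cons.prems by (auto elim!: letterE intro!: rw_swap')
  also have "rw m \<dots> ((l # W) @ (q, c) # V)"
    using Cons by (auto intro!: rw_Cons)
  finally show ?case .
qed (simp add: rw_refl)

lemma rw_words_left':
  assumes "W \<in> words n" "\<forall>l\<in>set V. n \<le> fst l"
  shows "rw m (V @ W) (W @ V)"
  using assms(2)
proof (induction V arbitrary: m)
  case (Cons l V)
  obtain q c where l: "l = (q, c)" by (cases l)
  have "rw m ((l # V) @ W) (l # W @ V)"
    using Cons by (auto intro!: rw_Cons)
  also have "rw m \<dots> (W @ l # V)"
    unfolding l using Cons.prems l by (intro rw_words_left[OF assms(1)]) auto
  finally show ?case .
qed (simp add: rw_refl)

text \<open>On one string the only letters are dots, and the crossing absorbs them one by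
  one.\<close>

lemma rw_absorb_words_below:
  assumes "W \<in> words 1"
  shows "rw m (W @ cross 0 # V) (cross 0 # V)"
  using assms
proof (induction W arbitrary: m)
  case (Cons l W)
  then have l: "l = dot 0" by (auto elim!: letterE)
  have "rw m ((l # W) @ cross 0 # V) (l # cross 0 # V)"
    using Cons by (auto intro!: rw_Cons)
  also have "rw m \<dots> (cross 0 # V)"
    using rw_suffix[OF rw_absorb_below_left, of m 0 V] by (simp add: l)
  finally show ?case .
qed (simp add: rw_refl)

lemma rw_absorb_words_above:
  assumes "W \<in> words 1"
  shows "rw m (cross 0 # W @ V) (cross 0 # V)"
  using assms
proof (induction W arbitrary: m)
  case (Cons l W)
  then have l: "l = dot 0" by (auto elim!: letterE)
  have "rw m (cross 0 # (l # W) @ V) (cross 0 # W @ V)"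
    using rw_suffix[OF rw_absorb[of 0], of m 0 "W @ V"] by (simp add: l)
  also have "rw m \<dots> (cross 0 # V)"
    using Cons by auto
  finally show ?case .
qed (simp add: rw_refl)

lemma sred_prefix:
  "wf_tangle (\<lambda>_ _. UNIV) s m V w \<Longrightarrow> sred w W H \<Longrightarrow> sred m (V @ W) ((\<lambda>U. V @ U) ` H)"
  using sred_context[of m V w W H "[]"] by simp

lemma sred_suffix: "sred m W H \<Longrightarrow> sred m (W @ V) ((\<lambda>U. U @ V) ` H)"
  using sred_context[of m "[]" m W H V] by simp

text \<open>Letters are appended one at a time. The only dangerous one is a second
  \<open>cross (n - 2)\<close>: the word between the two copies lives on one string fewer, so by
  induction it contains \<open>cross (n - 3)\<close> just once. The rest of it commutes with
  \<open>cross (n - 2)\<close>, and the Yang--Baxter move leaves a single copy.\<close>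

lemma sred_words_one_cross:
  assumes "W \<in> words n" "2 \<le> n" "n \<le> m"
  shows "sred m W {W1 @ cross (n - 2) # W2 |W1 W2. W1 \<in> words (n - 1) \<and> W2 \<in> words (n - 1)}"
  using assms(2,1,3)
proof (induction n arbitrary: W m rule: less_induct)
  case (less n)
  let ?G = "{W1 @ cross (n - 2) # W2 |W1 W2. W1 \<in> words (n - 1) \<and> W2 \<in> words (n - 1)}"
  have letter: "sred m (V @ [l]) ?G" if "V \<in> ?G" "letter n l" for V l
  proof -
    from that(1) obtain W1 W2 where V: "V = W1 @ cross (n - 2) # W2"
      and W: "W1 \<in> words (n - 1)" "W2 \<in> words (n - 1)" by blast
    from that(2) consider "letter (n - 1) l" | "l = dot (n - 1)" | "l = cross (n - 2)"
      using \<open>2 \<le> n\<close> by (auto elim!: letterE) force+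
    then show ?thesis
    proof cases
      case 1
      then show ?thesis using W unfolding V
        by (intro sred_refl CollectI exI[of _ W1] exI[of _ "W2 @ [l]"]) simp
    next
      case 2
      \<comment> \<open>The dot sits on the last string, which no letter of \<open>W2\<close>
        touches, so it slides down to the crossing and is absorbed on its right leg.\<close>
      have "rw m (V @ [l]) (W1 @ cross (n - 2) # dot (n - 1) # W2)"
        unfolding V 2 using rw_prefix[OF rw_words_right[OF W(2) order_refl], of m "W1 @ [cross (n
            - 2)]" "Box (Suc 0) ()" "[]"]
        by simp
      also have "rw m \<dots> (W1 @ cross (n - 2) # W2)"
        using rw_context[OF rw_absorb[of 1], of m W1 "n - 2" W2] \<open>2 \<le> n\<close>
        by (simp add: Suc_diff_Suc numeral_2_eq_2)
      finally show ?thesis by (rule sred_rw) (use W in blast)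
    next
      case 3
      show ?thesis
      proof (cases "n = 2")
        case True
        \<comment> \<open>On two strings \<open>W2\<close> consists of dots on string
          \<open>0\<close>; once the lower crossing has absorbed them, the two crossings are
          adjacent and type II applies.\<close>
        have "rw m (V @ [l]) (W1 @ [cross 0, cross 0])"
          unfolding V 3 True using rw_prefix[OF rw_absorb_words_above, of W2 m W1 "[cross 0]"] W
              True by simp
        also have "rw m \<dots> (W1 @ [cross 0])"
          by (intro rw_prefix rw_type_II)
        finally show ?thesis by (rule sred_rw) (use W True in force)
      next
        case False
        then obtain k where n: "n = k + 3" using \<open>2 \<le> n\<close>
          by (intro that[of "n - 3"]) simp
        have wf: "wf_tangle (\<lambda>_ _. UNIV) s m (W1 @ [cross (n - 2)]) m"
          using wf_words[OF W(1), of m] \<open>n \<le> m\<close> \<open>2 \<le> n\<close>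
            by (auto simp: wf_append intro!: exI[of _ m])
        have "sred m W2 {U1 @ cross k # U2 |U1 U2. U1 \<in> words (k + 1) \<and> U2 \<in> words (k + 1)}"
          using less.IH[of "k + 2" W2 m] W(2) \<open>n \<le> m\<close> by (simp add: n)
        from sred_context[OF wf this, of "[cross (n - 2)]"]
        have "sred m (V @ [l]) ((\<lambda>U. W1 @ cross (n - 2) # U @ [cross (n - 2)]) `
             {U1 @ cross k # U2 |U1 U2. U1 \<in> words (Suc k) \<and> U2 \<in> words (Suc k)})"
          by (simp add: V 3)
        then show ?thesis
        proof (rule sred_trans)
          fix U
          assume "U \<in> (\<lambda>U. W1 @ cross (n - 2) # U @ [cross (n - 2)]) `
             {U1 @ cross k # U2 |U1 U2. U1 \<in> words (Suc k) \<and> U2 \<in> words (Suc k)}"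
          then obtain U1 U2 where U: "U = W1 @ cross (Suc k) # (U1 @ cross k # U2) @ [cross (Suc
              k)]"
            and U': "U1 \<in> words (Suc k)" "U2 \<in> words (Suc k)" by (auto simp: n)
          have "rw m U ((W1 @ U1) @ cross (Suc k) # cross k # U2 @ [cross (Suc k)])"
            unfolding U using rw_prefix[OF rw_words_left[OF U'(1) order_refl], of m W1 "Box 2 ()"
                "cross k # U2 @ [cross (Suc k)]"]
            by simp
          also have "rw m \<dots> ((W1 @ U1) @ cross (Suc k) # cross k # cross (Suc k) # U2)"
            using rw_prefix[OF rw_words_right[OF U'(2) order_refl], of m "W1 @ U1 @ [cross (Suc
                k), cross k]" "Box 2 ()" "[]"]
            by simp
          also have "rw m \<dots> ((W1 @ U1) @ [cross k, cross (Suc k), cross k] @ U2)"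
            using rw_context[OF rw_type_III, of m "W1 @ U1" k U2] by simp
          also have "\<dots> = (W1 @ U1 @ [cross k]) @ cross (n - 2) # (cross k # U2)"
            by (simp add: n)
          finally show "sred m U ?G"
          proof (rule sred_rw)
            have "W1 @ U1 @ [cross k] \<in> words (n - 1)" "cross k # U2 \<in> words (n - 1)"
              using W U' words_mono[of _ "Suc k" "n - 1"] by (simp_all add: n)
            then show "(W1 @ U1 @ [cross k]) @ cross (n - 2) # (cross k # U2) \<in> ?G" by blast
          qed
        qed
      qed
    qed
  qed
  from \<open>W \<in> words n\<close> show "sred m W ?G"
  proof (induction W rule: rev_induct)
    case Nil
    \<comment> \<open>Without any crossing of the last two strings, one is inserted; only then is
      "exactly once" attainable rather than "at most once".\<close>
    have "rw m [] [cross (n - 2)]" using less.prems by (intro rw_insert) auto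
    then show ?case by (rule sred_rw) force
  next
    case (snoc l W)
    then have "sred m W ?G" by simp
    from sred_suffix[OF this] show ?case
    proof (rule sred_trans)
      fix U assume "U \<in> (\<lambda>U. U @ [l]) ` ?G"
      then obtain V where "V \<in> ?G" "U = V @ [l]" by (rule imageE)
      moreover have "letter n l" using snoc.prems by simp
      ultimately show "sred m U ?G" using letter by (simp only:)
    qed
  qed
qed

lemma rw_words_1:
  assumes "W \<in> words 1" "1 \<le> m"
  shows "rw m W [(1, Cup), cross 0, (0, Cap)]"
proof -
  have "rw m W (W @ [(1, Cup), (0, Cap)])"
    using rw_zigzagI(2)[of m W m 0 "[]"] wf_words[OF assms] assms(2) by simp
  also have "rw m \<dots> ((1, Cup) # W @ [(0, Cap)])"
    by (rule rw_words_right[OF assms(1)]) simp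
  also have "rw m \<dots> ((1, Cup) # W @ [cross 0, (0, Cap)])"
    using rw_insertI[of m "(1, Cup) # W" "m + 2" 0 "[(0, Cap)]"] wf_words[OF assms(1), of "m + 2"]
        assms(2)
    by simp
  also have "rw m \<dots> [(1, Cup), cross 0, (0, Cap)]"
    by (intro rw_Cons rw_absorb_words_below[OF assms(1)])
  finally show ?thesis .
qed

text \<open>After splitting at the last crossing, induction applies to both halves. They still sit
  inside all \<open>m\<close> strings, which is why \<open>m\<close> may exceed
  \<open>n\<close>.\<close>

lemma rw_words_normal:
  assumes "W \<in> words n" "n \<le> m"
  shows "rw m W (normal_word n)"
  using assms
proof (induction n arbitrary: W m rule: normal_word.induct)
  case 1
  then show ?case by (simp add: words_0 rw_refl)
next
  case 2
  then show ?case using rw_words_1 by simp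
next
  case (3 n)
  have "sred m W {W1 @ cross n # W2 |W1 W2. W1 \<in> words (Suc n) \<and> W2 \<in> words (Suc n)}"
    using sred_words_one_cross[OF 3(3) _ 3(4)] by simp
  then show ?case
    unfolding rw_def
  proof (rule sred_trans)
    fix V assume "V \<in> {W1 @ cross n # W2 |W1 W2. W1 \<in> words (Suc n) \<and> W2 \<in> words (Suc n)}"
    then obtain W1 W2 where V: "V = W1 @ cross n # W2" and W: "W1 \<in> words (Suc n)" "W2 \<in> words
        (Suc n)"
      by blast
    have wf: "wf_tangle (\<lambda>_ _. UNIV) s m (W1 @ [cross n]) m"
      using wf_words[OF W(1), of m] 3(4) by (auto simp: wf_append intro!: exI[of _ m])
    have "rw m V (W1 @ cross n # normal_word (Suc n))"
      unfolding V using rw_contextI[OF wf 3(1)[OF W(2)], of "[]"] 3(4) by simp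
    also have "rw m \<dots> (normal_word (Suc (Suc n)))"
      using rw_contextI[of m "[]" m W1 "normal_word (Suc n)"] 3(1)[OF W(1), of m] 3(4) by simp
    finally show "sred m V {normal_word (Suc (Suc n))}" unfolding rw_def .
  qed
qed

text \<open>The last string is closed on its right. As the last crossing occurs only once, the rest
  slides out of the closure, and type I turns the partial trace of that crossing into a dot. For
  \<open>n = 1\<close> the closure is a circle with dots, absorbed by a crossing inserted across its
  two strands.\<close>

lemma sred_partial_trace:
  assumes "W \<in> words n" "1 \<le> n" "m = n - 1"
  shows "sred m ((n - 1, Cup) # W @ [(n - 1, Cap)]) (words (n - 1))"
proof (cases "n = 1")
  case True
  have "rw m ((0, Cup) # W @ [(0, Cap)]) ((0, Cup) # W @ [cross 0, (0, Cap)])"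
    using rw_insertI[of m "(0, Cup) # W" "m + 2" 0 "[(0, Cap)]"] wf_words[OF assms(1), of "m + 2"]
        True
    by simp
  also have "rw m \<dots> [(0, Cup), cross 0, (0, Cap)]"
    using rw_Cons[OF rw_absorb_words_below] assms(1) True by simp
  also note rw_circle
  finally have "rw m ((0, Cup) # W @ [(0, Cap)]) []" .
  from sred_rw[OF this, of "words 0"] show ?thesis by (simp add: True)
next
  case False
  then obtain k where n: "n = k + 2" using assms(2) by (intro that[of "n - 2"]) simp
  have wf: "wf_tangle (\<lambda>_ _. UNIV) s m [(n - 1, Cup)] (m + 2)"
    using assms by simp
  have "sred (m + 2) W {W1 @ cross k # W2 |W1 W2. W1 \<in> words (Suc k) \<and> W2 \<in> words (Suc k)}"
    using sred_words_one_cross[of W n "m + 2"] assms by (simp add: n)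
  from sred_context[OF wf this, of "[(n - 1, Cap)]"]
  have "sred m ((n - 1, Cup) # W @ [(n - 1, Cap)])
     ((\<lambda>U. (Suc k, Cup) # U @ [(Suc k, Cap)]) ` {W1 @ cross k # W2 |W1 W2. W1 \<in> words (Suc k) \<and> W2
         \<in> words (Suc k)})"
    by (simp add: n)
  then show ?thesis
  proof (rule sred_trans)
    fix V assume "V \<in> (\<lambda>U. (Suc k, Cup) # U @ [(Suc k, Cap)]) ` {W1 @ cross k # W2 |W1 W2. W1 \<in>
        words (Suc k) \<and> W2 \<in> words (Suc k)}"
    then obtain W1 W2 where V: "V = (Suc k, Cup) # (W1 @ cross k # W2) @ [(Suc k, Cap)]"
      and W: "W1 \<in> words (Suc k)" "W2 \<in> words (Suc k)" by blast
    have "rw m V (W1 @ (Suc k, Cup) # cross k # W2 @ [(Suc k, Cap)])"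
      unfolding V using rw_words_left[OF W(1) order_refl] by simp
    also have "rw m \<dots> (W1 @ (Suc k, Cup) # cross k # (Suc k, Cap) # W2)"
      using rw_prefix[OF rw_words_right[OF W(2) order_refl], of m "W1 @ [(Suc k, Cup), cross k]"
          Cap "[]"]
      by simp
    also have "rw m \<dots> (W1 @ dot k # W2)"
      using rw_context[OF rw_type_I, of m W1 k W2] by simp
    finally show "sred m V (words (n - 1))"
      by (rule sred_rw) (use W in \<open>simp add: n\<close>)
  qed
qed

text \<open>Unlike in a partial trace, both strings of the cup enter the word. Isolating the
  crossing of the last pair and, below it, that of the pair before gives a cup under two
  neighbouring crossings. The second is absorbed, and the remaining word avoids the outermost
  string.\<close>

lemma sred_cup_words_cap:
  assumes "W \<in> words (n + 2)" "m = n"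
  shows "sred m ((n, Cup) # W @ [(n, Cap)]) (words n)"
proof -
  have wf: "wf_tangle (\<lambda>_ _. UNIV) s m [(n, Cup)] (n + 2)"
    using assms by simp
  have "sred (n + 2) W {W1 @ cross n # W2 |W1 W2. W1 \<in> words (Suc n) \<and> W2 \<in> words (Suc n)}"
    using sred_words_one_cross[of W "n + 2" "n + 2"] assms by simp
  from sred_context[OF wf this, of "[(n, Cap)]"]
  have "sred m ((n, Cup) # W @ [(n, Cap)])
     ((\<lambda>U. (n, Cup) # U @ [(n, Cap)]) ` {W1 @ cross n # W2 |W1 W2. W1 \<in> words (Suc n) \<and> W2 \<in> words
         (Suc n)})"
    by simp
  then show ?thesis
  proof (rule sred_trans)
    fix V assume "V \<in> (\<lambda>U. (n, Cup) # U @ [(n, Cap)]) ` {W1 @ cross n # W2 |W1 W2. W1 \<in> words (Suc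
        n) \<and> W2 \<in> words (Suc n)}"
    then obtain W1 W2 where V: "V = (n, Cup) # (W1 @ cross n # W2) @ [(n, Cap)]"
      and W: "W1 \<in> words (Suc n)" "W2 \<in> words (Suc n)" by blast
    show "sred m V (words n)"
    proof (cases n)
      case 0
      \<comment> \<open>With no string besides the cup, both \<open>W1\<close> and \<open>W2\<close>
        consist of dots, and a circle with one crossing remains.\<close>
      have "rw m V ((0, Cup) # cross 0 # W2 @ [(0, Cap)])"
        unfolding V 0 using rw_Cons[OF rw_absorb_words_below[of W1 _ "W2 @ [(0, Cap)]"]] W(1) 0 by
            simp
      also have "rw m \<dots> [(0, Cup), cross 0, (0, Cap)]"
        using W(2) 0 by (intro rw_Cons rw_absorb_words_above) simp
      also note rw_circle
      finally show ?thesis by (rule sred_rw) simp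
    next
      case (Suc k)
      have "sred (n + 2) W1 {U1 @ cross k # U2 |U1 U2. U1 \<in> words (Suc k) \<and> U2 \<in> words (Suc k)}"
        using sred_words_one_cross[OF W(1), of "n + 2"] by (simp add: Suc)
      from sred_context[OF wf this, of "cross n # W2 @ [(n, Cap)]"]
      have "sred m V ((\<lambda>U. (Suc k, Cup) # U @ cross (Suc k) # W2 @ [(Suc k, Cap)]) `
          {U1 @ cross k # U2 |U1 U2. U1 \<in> words (Suc k) \<and> U2 \<in> words (Suc k)})"
        unfolding V Suc by simp
      then show ?thesis
      proof (rule sred_trans)
        fix U
        assume "U \<in> (\<lambda>U. (Suc k, Cup) # U @ cross (Suc k) # W2 @ [(Suc k, Cap)]) `
          {U1 @ cross k # U2 |U1 U2. U1 \<in> words (Suc k) \<and> U2 \<in> words (Suc k)}"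
        then obtain U1 U2
          where U: "U = (Suc k, Cup) # (U1 @ cross k # U2) @ cross (Suc k) # W2 @ [(Suc k, Cap)]"
            and U': "U1 \<in> words (Suc k)" "U2 \<in> words (Suc k)" by blast
        have "rw m U (U1 @ (Suc k, Cup) # cross k # U2 @ cross (Suc k) # W2 @ [(Suc k, Cap)])"
          unfolding U using rw_words_left[OF U'(1) order_refl] by simp
        also have "rw m \<dots> (U1 @ (Suc k, Cup) # cross k # cross (Suc k) # U2 @ W2 @ [(Suc k, Cap)])"
          using rw_prefix[OF rw_words_right[OF U'(2) order_refl], of m "U1 @ [(Suc k, Cup), cross
              k]"]
          by simp
        also have "rw m \<dots> (U1 @ (Suc k, Cup) # cross k # U2 @ W2 @ [(Suc k, Cap)])"
          using rw_context[OF rw_cup_cross_cross, of m U1 k "U2 @ W2 @ [(Suc k, Cap)]"] by simp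
        \<comment> \<open>The cup returns below \<open>U1\<close> to exhibit a partial trace of a
          word on \<open>n + 1\<close> strings.\<close>
        also have "rw m \<dots> ((Suc k, Cup) # U1 @ cross k # U2 @ W2 @ [(Suc k, Cap)])"
          by (rule rw_words_right[OF U'(1) order_refl])
        finally show "sred m U (words n)"
        proof (rule rw_sred)
          have "U1 @ cross k # U2 @ W2 \<in> words (n + 1)"
            using U' W(2) words_mono[of _ "Suc k" "n + 1"] by (simp add: Suc)
          from sred_partial_trace[OF this, of m] assms(2)
          show "sred m ((Suc k, Cup) # U1 @ cross k # U2 @ W2 @ [(Suc k, Cap)]) (words n)"
            by (simp add: Suc)
        qed
      qed
    qed
  qed
qed

section \<open>Bringing tangles to standard form\<close>

lemma wf_cups: "wf_tangle (\<lambda>_ _. UNIV) s m (cups m k) (m + 2 * k)"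
  by (induction k) (auto simp: wf_append)

text \<open>One step to the right: a zigzag creates a cup at \<open>Suc p\<close> together with a
  cap, and this cap meets the old cup and becomes a crossing.\<close>

lemma rw_cup_right:
  assumes "p \<le> n"
  shows "\<exists>Q\<in>words (Suc n). rw n [(p, Cup)] ((n, Cup) # Q)"
  using assms
proof (induction "n - p" arbitrary: p)
  case 0
  then show ?case by (intro bexI[of _ "[]"]) (auto simp: rw_refl)
next
  case (Suc k)
  then obtain Q where Q: "Q \<in> words (Suc n)" "rw n [(Suc p, Cup)] ((n, Cup) # Q)"
    by (metis Suc_diff_Suc Suc_inject diff_is_0_eq less_eq_Suc_le nat_le_linear zero_less_Suc
        zero_less_diff)
  have "rw n [(p, Cup)] [(Suc p, Cup), (p, Cap), (p, Cup)]"
    using rw_zigzagI(2)[of n "[]" n p "[(p, Cup)]"] Suc by simp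
  also have "rw n \<dots> [(Suc p, Cup), cross p]"
    by (intro rw_Cons rw_cap_cup)
  also have "rw n \<dots> ((n, Cup) # Q @ [cross p])"
    using rw_contextI[of n "[]" n, OF _ Q(2), of "[cross p]"] by simp
  finally show ?case using Q(1) Suc by (intro bexI[of _ "Q @ [cross p]"]) auto
qed

text \<open>The same as for cups, upside down: the cup of a zigzag meets the old cap in a crossing,
  and the cap of the zigzag is one place further right.\<close>

lemma rw_cap_right:
  assumes "p \<le> n"
  shows "\<exists>Q\<in>words (Suc n). rw (n + 2) [(p, Cap)] (Q @ [(n, Cap)])"
  using assms
proof (induction "n - p" arbitrary: p)
  case 0
  then show ?case by (intro bexI[of _ "[]"]) (auto simp: rw_refl)
next
  case (Suc k)
  then obtain Q where Q: "Q \<in> words (Suc n)" "rw (n + 2) [(Suc p, Cap)] (Q @ [(n, Cap)])"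
    by (metis Suc_diff_Suc Suc_inject diff_is_0_eq less_eq_Suc_le nat_le_linear zero_less_Suc
        zero_less_diff)
  have "rw (n + 2) [(p, Cap)] [(p, Cap), (p, Cup), (Suc p, Cap)]"
    using rw_zigzagI(1)[of "n + 2" "[(p, Cap)]" n p "[]"] Suc by simp
  also have "rw (n + 2) \<dots> [cross p, (Suc p, Cap)]"
    using rw_suffix[OF rw_cap_cup, of "n + 2" p "[(Suc p, Cap)]"] by simp
  also have "rw (n + 2) \<dots> (cross p # Q @ [(n, Cap)])"
    using rw_contextI[of "n + 2" "[cross p]" "n + 2", OF _ Q(2), of "[]"] Suc by simp
  finally show ?case using Q(1) Suc by (intro bexI[of _ "cross p # Q"]) auto
qed


text \<open>Final caps lie to the right of the \<open>n\<close> surviving strings, so a letter on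
  these strings slides below the caps into the word.\<close>

lemma sred_letter:
  assumes V: "V \<in> standard m n" "even (m + n)" and l: "letter n l"
  shows "sred m (V @ [l]) (standard m n)"
  using V
proof (cases rule: standard_cases)
  case (1 k W)
  then have "V @ [l] \<in> standard m n" using l standard_grow[of "W @ [l]" m k] by simp
  then show ?thesis by (rule sred_refl)
next
  case (2 k W)
  have "rw m (V @ [l]) (W @ [l] @ caps n (Suc k))"
    using rw_prefix[OF rw_words_left'[of "[l]" n "caps n (Suc k)"], of m W] l caps_ge[of _ n "Suc
        k"] 2
    by (simp del: caps.simps)
  then show ?thesis
  proof (rule sred_rw)
    show "W @ [l] @ caps n (Suc k) \<in> standard m n"
      using 2 l standard_shrink[of "W @ [l]" n "Suc k"] words_mono[of "[l]" n m] by simp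
  qed
qed

text \<open>If strings have been lost, the new cup merges with the last cap into a crossing.
  Otherwise it slides below the word and joins the cups.\<close>

lemma sred_cup:
  assumes V: "V \<in> standard m n" "even (m + n)" and wf: "wf_tangle (\<lambda>_ _. UNIV) s m V n" and p: "p
      \<le> n"
  shows "sred m (V @ [(p, Cup)]) (standard m (n + 2))"
proof -
  from rw_cup_right[OF p] obtain Q where Q: "Q \<in> words (Suc n)" "rw n [(p, Cup)] ((n, Cup) # Q)"
      by blast
  have *: "rw m (V @ [(p, Cup)]) (V @ (n, Cup) # Q)"
    using rw_contextI[OF wf Q(2), of "[]"] by simp
  from V show ?thesis
  proof (cases rule: standard_cases)
    case (1 k W)
    note *
    also have "rw m (V @ (n, Cup) # Q) (cups m (Suc k) @ W @ Q)"
      using rw_prefix[OF rw_words_right[of W n n _ Cup Q], of m "cups m k"] 1 by simp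
    finally show ?thesis
    proof (rule sred_rw)
      show "cups m (Suc k) @ W @ Q \<in> standard m (n + 2)"
        using standard_grow[of "W @ Q" m "Suc k"] 1 Q(1) words_mono[of _ _ "n + 2"] by simp
    qed
  next
    case (2 k W)
    note *
    also have "rw m (V @ (n, Cup) # Q) ((W @ caps (n + 2) k) @ cross n # Q)"
      using rw_context[OF rw_cap_cup, of m "W @ caps (n + 2) k" n Q] 2 by simp
    also have "rw m \<dots> (W @ (cross n # Q) @ caps (n + 2) k)"
      using rw_prefix[OF rw_words_left'[of "cross n # Q" "n + 2" "caps (n + 2) k"], of m W]
        caps_ge Q(1) words_mono[of Q _ "n + 2"] by simp
    finally show ?thesis
    proof (rule sred_rw)
      show "W @ (cross n # Q) @ caps (n + 2) k \<in> standard m (n + 2)"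
        using standard_shrink[of "W @ cross n # Q" "n + 2" k] 2 Q(1) words_mono[of Q _ m] by simp
    qed
  qed
qed

text \<open>Only if strings have been gained does the new cap face a cup; the last cup and the cap
  then enclose the word and \<open>sred_cup_words_cap\<close> removes both. Otherwise the cap is
  simply recorded as one more final cap.\<close>

lemma sred_cap:
  assumes V: "V \<in> standard m (n + 2)" "even (m + n)"
    and wf: "wf_tangle (\<lambda>_ _. UNIV) s m V (n + 2)" and p: "p \<le> n"
  shows "sred m (V @ [(p, Cap)]) (standard m n)"
proof -
  from rw_cap_right[OF p] obtain Q
    where Q: "Q \<in> words (Suc n)" "rw (n + 2) [(p, Cap)] (Q @ [(n, Cap)])" by blast
  have *: "rw m (V @ [(p, Cap)]) (V @ Q @ [(n, Cap)])"
    using rw_contextI[OF wf Q(2), of "[]"] by simp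
  have even: "even (m + (n + 2))" using V(2) by simp
  from V(1) even show ?thesis
  proof (cases rule: standard_cases)
    case (1 k W)
    have WQ: "W @ Q \<in> words (n + 2)" using 1 Q(1) words_mono[of Q _ "n + 2"] by simp
    show ?thesis
    proof (cases k)
      case 0
      with 1 * have "rw m (V @ [(p, Cap)]) ((W @ Q) @ caps n 1)" by simp
      then show ?thesis
        using standard_shrink[of "W @ Q" n 1] WQ 0 1 by (intro sred_rw) auto
    next
      case (Suc k')
      then have n: "n = m + 2 * k'" using 1 by simp
      have "sred n ((n, Cup) # (W @ Q) @ [(n, Cap)]) (words n)"
        by (rule sred_cup_words_cap[OF WQ refl])
      from sred_prefix[OF wf_cups[of m k', folded n] this]
      have "sred m (cups m k' @ (n, Cup) # (W @ Q) @ [(n, Cap)]) (standard m n)"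
        by (rule sred_trans) (auto simp: n intro!: sred_refl standard_grow)
      moreover have "V @ Q @ [(n, Cap)] = cups m k' @ (n, Cup) # (W @ Q) @ [(n, Cap)]"
        using 1 Suc n by simp
      ultimately show ?thesis using rw_sred[OF *] by simp
    qed
  next
    case (2 k W)
    note *
    also have "rw m (V @ Q @ [(n, Cap)]) ((W @ Q) @ caps (n + 2) (Suc k) @ [(n, Cap)])"
      using rw_context[OF rw_words_left'[of Q "n + 2" "caps (n + 2) (Suc k)"], of m W "[(n, Cap)]"]
        caps_ge[of _ "n + 2" "Suc k"] 2 Q(1) words_mono[of Q _ "n + 2"] by auto
    also have "\<dots> = (W @ Q) @ caps n (Suc (Suc k))" by simp
    finally show ?thesis
    proof (rule sred_rw)
      show "(W @ Q) @ caps n (Suc (Suc k)) \<in> standard m n"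
        using standard_shrink[of "W @ Q" n "Suc (Suc k)"] 2 Q(1) words_mono[of Q _ m] by simp
    qed
  qed
qed

lemma wf_even: "wf_tangle L s' m T n \<Longrightarrow> even (m + n)"
proof (induction T arbitrary: m)
  case (Cons l T)
  obtain p c where "l = (p, c)" by (cases l)
  with Cons.prems Cons.IH[of "m - ins c + outs c"] show ?case by (cases c) auto
qed simp

lemma wf_caps: "wf_tangle (\<lambda>_ _. UNIV) s (n + 2 * k) (caps n k) n"
proof (induction k arbitrary: n)
  case (Suc k)
  from Suc.IH[of "n + 2"] show ?case by (auto simp: wf_append)
qed simp

lemma wf_standard:
  assumes "V \<in> standard m n" "even (m + n)"
  shows "wf_tangle (\<lambda>_ _. UNIV) s m V n"
  using assms
proof (cases rule: standard_cases)
  case (1 k W)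
  then show ?thesis using wf_cups[of m k] wf_words[of W n n] by (auto simp: wf_append)
next
  case (2 k W)
  then show ?thesis using wf_caps[of n "Suc k"] wf_words[of W m m] by (auto simp: wf_append simp
      del: caps.simps)
qed

lemma sred_standard:
  assumes "wf m T n"
  shows "sred m (shape T) (standard m n)"
  using assms
proof (induction T arbitrary: n rule: rev_induct)
  case Nil
  then have "[] \<in> standard m n" using standard_grow[of "[]" m 0] by simp
  then show ?case by (intro sred_refl) (simp add: shape_def)
next
  case (snoc l T)
  obtain p c where l: "l = (p, c)" by (cases l)
  from snoc.prems obtain w where T: "wf m T w" and p: "p + ins c \<le> w"
    and c: "case c of Box k v \<Rightarrow> v \<in> basis_labels I S J X k (shade_at s p) | _ \<Rightarrow> True"
    and n: "n = w - ins c + outs c"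
    by (auto simp: wf_append l)
  have "sred m (V @ [(p, map_piece (\<lambda>_. ()) c)]) (standard m n)" if V: "V \<in> standard m w" for V
  proof (cases c)
    case Cup
    then show ?thesis using sred_cup[OF V wf_even[OF T] wf_standard[OF V wf_even[OF T]]] p n by simp
  next
    case Cap
    then have w: "w = n + 2" using p n by simp
    have "even (m + n)" using wf_even[OF T] w by simp
    then show ?thesis
      using sred_cap[OF V[unfolded w] _ wf_standard[OF V wf_even[OF T], unfolded w], of p] p w Cap
          by simp
  next
    case (Box k v)
    then have "k = 1 \<or> k = 2" using c by (auto simp: basis_labels_def split: if_splits)
    then have "letter w (p, map_piece (\<lambda>_. ()) c)" using p Box by auto
    then show ?thesis using sred_letter[OF V wf_even[OF T]] p n Box by simp
  qed
  moreover have "shape (T @ [l]) = shape T @ [(p, map_piece (\<lambda>_. ()) c)]" by (simp add: l shape_def)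
  ultimately show ?case
    using sred_suffix[OF snoc.IH[OF T], of "[(p, map_piece (\<lambda>_. ()) c)]"]
    by (auto elim!: sred_trans)
qed

theorem good_if_normal_good:
  assumes T: "wf M T M"
    and good: "\<And>U. wf M U M \<Longrightarrow> shape U = normal_word M \<Longrightarrow> good U"
  shows "good T"
proof -
  \<comment> \<open>With equally many bottom and top points both outer parts of a standard shape are
    empty, so the standard shapes are just the words.\<close>
  have "sred M (shape T) {normal_word M}"
    by (rule sred_trans[OF sred_standard[OF T]])
      (auto simp: standard_def rw_def[symmetric] intro!: rw_words_normal)
  from sredD[OF this, of "[]" T M "[]"] show ?thesis
    using T good by auto
qed

end

section \<open>Soundness and reducibility of the moves\<close>

lemma wf_insert_box:
  assumes "wf_tangle L s m A w" "p + k \<le> w" "wf_tangle L s w B n" "v \<in> L k (shade_at s p)"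
  shows "wf_tangle L s m (A @ (p, Box k v) # B) n"
  unfolding wf_append using assms by (intro exI[of _ w]) simp

lemma isotopic_step:
  assumes "isotopy_gen u v" "wf_tangle L s m (A @ u @ B) n" "wf_tangle L s m (A @ v @ B) n"
  shows "isotopic L s m n (A @ u @ B) (A @ v @ B)"
  unfolding isotopic_def
  by (rule r_into_equivclp) (use assms in blast)

lemma isotopic_sym: "isotopic L s m n T U \<Longrightarrow> isotopic L s m n U T"
  unfolding isotopic_def by (rule equivclp_sym)

lemma isotopic_mono:
  assumes "\<And>k t. L k t \<subseteq> L' k t" "isotopic L s m n T U"
  shows "isotopic L' s m n T U"
proof -
  let ?R = "\<lambda>L T U. wf_tangle L s m T n \<and> wf_tangle L s m U n \<and>
     (\<exists>A B u v. isotopy_gen u v \<and> T = A @ u @ B \<and> U = A @ v @ B)"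
  have "?R L \<le> ?R L'" using wf_mono[of L L', OF assms(1)] by blast
  then have "symclp (?R L) \<le> symclp (?R L')" unfolding symclp_def by blast
  then show ?thesis
    using assms(2) rtranclp_mono[of "symclp (?R L)" "symclp (?R L')"]
    unfolding isotopic_def equivclp_def by blast
qed

lemma wf_place:
  "wf_tangle L (shade_at s p) k T k' \<Longrightarrow> p + k \<le> w \<Longrightarrow> wf_tangle L s w (place p T) (w - k + k')"
proof (induction T arbitrary: k w)
  case (Cons l T)
  obtain q c where l: "l = (q, c)" by (cases l)
  from Cons.prems have wf: "q + ins c \<le> k" "wf_tangle L (shade_at s p) (k - ins c + outs c) T k'"
    by (auto simp: l)
  have "wf_tangle L s (w - ins c + outs c) (place p T)
      ((w - ins c + outs c) - (k - ins c + outs c) + k')"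
    using wf Cons.prems(2) by (intro Cons.IH) auto
  moreover have "(w - ins c + outs c) - (k - ins c + outs c) = w - k"
    using wf(1) Cons.prems(2) by simp
  ultimately show ?case using Cons.prems by (auto simp: l shade_at_add split: piece.splits)
qed simp

lemma wf_place_same:
  "wf_tangle L (shade_at s p) k T k \<Longrightarrow> p + k \<le> w \<Longrightarrow> wf_tangle L s w (place p T) w"
  using wf_place[of L s p k T k w] by simp

lemma turn_Suc: "turn k (Suc r) T = (0, Cup) # place 1 (turn k r T) @ [(k, Cap)]"
  by (simp add: turn_def)

lemma turn_0 [simp]: "turn k 0 T = T"
  by (simp add: turn_def)

lemma wf_turn:
  assumes "wf_tangle L s k T k" "1 \<le> k"
  shows "wf_tangle L (shade_at s r) k (turn k r T) k"
proof (induction r)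
  case (Suc r)
  have "wf_tangle L (shade_at s (Suc r)) (k + 2) (place 1 (turn k r T)) (k + 2)"
    using Suc by (intro wf_place_same) auto
  then show ?case using assms(2) by (auto simp: turn_Suc wf_append intro!: exI[of _ "k + 2"])
qed (use assms in simp)

lemma fill_place [simp]: "fill f (place p T) = place p (fill f T)"
  by (auto simp: fill_def place_def)

lemma fill_box [simp]: "fill f (box k v) = box k (f v)"
  by (simp add: box_def)

lemma fill_turn [simp]: "fill f (turn k r T) = turn k r (fill f T)"
  by (induction r) (simp_all add: turn_Suc)

lemma fill_close_right [simp]: "fill f (close_right k T) = close_right k (fill f T)"
  by (simp add: close_right_def)

lemma fill_stack [simp]: "fill f (stack T U) = stack (fill f T) (fill f U)"
  by (simp add: stack_def)

lemma fill_case_sum_Inr: "fill (case_sum f g) (fill Inr T) = fill g T"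
proof -
  have "map_piece (case_sum f g) (map_piece Inr c) = map_piece g c" for c by (cases c) auto
  then show ?thesis by (simp add: fill_def case_prod_beta)
qed

lemma isotopy_gen_fill: "isotopy_gen u v \<Longrightarrow> isotopy_gen (fill f u) (fill f v)"
proof (induction rule: isotopy_gen.induct)
  case (exchange p c q d)
  then show ?case using isotopy_gen.exchange[of p "map_piece f c" q "map_piece f d"] by simp
next
  case (zigzag_left p)
  then show ?case using isotopy_gen.zigzag_left by simp
next
  case (zigzag_right p)
  then show ?case using isotopy_gen.zigzag_right by simp
next
  case (half_turn p k v)
  have "fill f (nested_cups q k) = nested_cups q k" "fill f (nested_caps q k) = nested_caps q k"
      for q
    by (simp_all add: fill_def nested_cups_def nested_caps_def)
  then show ?case using isotopy_gen.half_turn[of p k "f v"] by simp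
qed

lemma wf_box: "wf_tangle (basis_labels I S J X) t k (box k v) k \<longleftrightarrow> v \<in> basis_labels I S J X k t"
  by (auto simp: box_def)

lemma wf_stack:
  "wf_tangle L t k U k \<Longrightarrow> wf_tangle L t k T k \<Longrightarrow> wf_tangle L t k (stack T U) k"
  by (auto simp: stack_def wf_append)

lemma wf_close_right:
  "wf_tangle L t k T k \<Longrightarrow> 1 \<le> k \<Longrightarrow> wf_tangle L t (k - 1) (close_right k T) (k - 1)"
  using wf_place_same[of L t 0 k T "Suc k"]
  by (auto simp: close_right_def wf_append Suc_diff_Suc intro!: exI[of _ "Suc k"])

lemma keys_sum_subset:
  "Poly_Mapping.keys (\<Sum>i\<in>A. g i) \<subseteq> C" if "\<And>i. i \<in> A \<Longrightarrow> Poly_Mapping.keys (g i) \<subseteq> C"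
  using keys_sum[of g A] that by blast

lemma type_I_II_move_wf:
  assumes "type_I_II_move I S J X K t k T g"
  shows "wf_tangle (basis_labels I S J X) t k T k"
    "U \<in> Poly_Mapping.keys g \<Longrightarrow> wf_tangle (basis_labels I S J X) t k U k"
proof -
  let ?L = "basis_labels I S J X"
  have turned: "wf_tangle ?L (shade_at s' r) l (turn l r (box l v)) l"
    if "v \<in> ?L l s'" "1 \<le> l" for s' r l v
    using that by (intro wf_turn) (simp_all add: wf_box)
  have "wf_tangle ?L t k T k \<and> Poly_Mapping.keys g \<subseteq> {U. wf_tangle ?L t k U k}"
    using assms
  proof cases
    case (type_I j s' r)
    have "wf_tangle ?L (shade_at s' r) 2 (turn 2 r (box 2 (X j))) 2"
      using type_I(5) by (intro turned) auto
    from wf_close_right[OF this] show ?thesis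
      unfolding type_I(1-4) by (auto intro!: keys_sum_subset simp: wf_box split: if_splits)
  next
    case (type_I' i s' r)
    have "wf_tangle ?L (shade_at s' r) 1 (turn 1 r (box 1 (S i))) 1"
      using type_I'(5) by (intro turned) auto
    from wf_close_right[OF this] show ?thesis
      unfolding type_I'(1-4) by simp
  next
    case (type_II j s' r k' s'' r')
    have "wf_tangle ?L t 2 (turn 2 r (box 2 (X j))) 2"
      unfolding type_II(8)[symmetric] using type_II(4) by (intro turned) auto
    moreover have "wf_tangle ?L t 2 (turn 2 r' (box 2 (X k'))) 2"
      unfolding type_II(9)[symmetric] using type_II(6) by (intro turned) auto
    ultimately show ?thesis
      unfolding type_II(1-3) by (auto intro!: keys_sum_subset wf_stack simp: wf_box split:
          if_splits)
  next
    case (type_II' i s' j c r U)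
    have "wf_tangle ?L (shade_at t c) 1 (turn 1 r (box 1 (S i))) 1"
      unfolding type_II'(8)[symmetric] using type_II'(4) by (intro turned) auto
    then have "wf_tangle ?L t 2 U 2"
      unfolding type_II'(9) by (rule wf_place_same) (use type_II'(6) in simp)
    moreover have "wf_tangle ?L t 2 (box 2 (X j)) 2" using type_II'(5) by (simp add: wf_box)
    ultimately show ?thesis
      unfolding type_II'(1-3) by (auto intro!: keys_sum_subset wf_stack simp: wf_box split:
          if_splits)
  qed
  then show "wf_tangle ?L t k T k"
    "U \<in> Poly_Mapping.keys g \<Longrightarrow> wf_tangle ?L t k U k" by auto
qed

lemma type_III_move_wf:
  assumes "type_III_move J X K t k T g"
  shows "wf_tangle (basis_labels I S J X) t k T k"
    "U \<in> Poly_Mapping.keys g \<Longrightarrow> wf_tangle (basis_labels I S J X) t k U k"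
proof -
  have "wf_tangle (basis_labels I S J X) t k T k \<and>
      Poly_Mapping.keys g \<subseteq> {U. wf_tangle (basis_labels I S J X) t k U k}"
    using assms
  proof cases
    case (type_III i j l)
    then show ?thesis
      by (auto intro!: keys_sum_subset simp: box_def stack_def split: if_splits)
  qed
  then show "wf_tangle (basis_labels I S J X) t k T k"
    "U \<in> Poly_Mapping.keys g \<Longrightarrow> wf_tangle (basis_labels I S J X) t k U k" by auto
qed

lemma keys_map_mult: "Poly_Mapping.keys (Poly_Mapping.map ((*) a) (h :: _ \<Rightarrow>\<^sub>0 'k::field)) \<subseteq>
    Poly_Mapping.keys h"
  by (auto simp: in_keys_iff map.rep_eq when_def)

lemma lookup_map_mult: "Poly_Mapping.lookup (Poly_Mapping.map ((*) a) (h :: _ \<Rightarrow>\<^sub>0 'k::field)) x =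
    a * Poly_Mapping.lookup h x"
  by (auto simp: map.rep_eq when_def)

section \<open>Formal linear combinations and multilinearity\<close>

context planar_algebra
begin

text \<open>The index type is left open: besides combinations of tangles, combinations of basis
  indices occur when a box is inserted.\<close>

definition linear_extension :: "('t \<Rightarrow> 'v) \<Rightarrow> ('t \<Rightarrow>\<^sub>0 'k) \<Rightarrow> 'v" where
  "linear_extension z g = (\<Sum>U\<in>Poly_Mapping.keys g. scale (Poly_Mapping.lookup g U) (z U))"

lemma linear_extension_superset:
  fixes g :: "'t \<Rightarrow>\<^sub>0 'k"
  assumes "finite F" "Poly_Mapping.keys g \<subseteq> F"
  shows "linear_extension z g = (\<Sum>U\<in>F. scale (Poly_Mapping.lookup g U) (z U))"
  unfolding linear_extension_def using assms
  by (intro sum.mono_neutral_left) (auto simp: in_keys_iff)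

lemma linear_extension_0 [simp]: "linear_extension z 0 = 0"
  by (simp add: linear_extension_def)

lemma linear_extension_single [simp]:
  "linear_extension z (Poly_Mapping.single U a) = scale a (z U)"
  by (simp add: linear_extension_def)

lemma linear_extension_add [simp]:
  fixes g :: "'t \<Rightarrow>\<^sub>0 'k"
  shows "linear_extension z (g + h) = linear_extension z g + linear_extension z h"
proof -
  let ?F = "Poly_Mapping.keys g \<union> Poly_Mapping.keys h"
  have "Poly_Mapping.keys (g + h) \<subseteq> ?F" by (rule keys_add)
  then show ?thesis
    using linear_extension_superset[of ?F g z] linear_extension_superset[of ?F h z]
      linear_extension_superset[of ?F "g + h" z]
    by (simp add: lookup_add scale_left_distrib sum.distrib)
qed

lemma linear_extension_sum [simp]:
  "linear_extension z (\<Sum>i\<in>A. g i) = (\<Sum>i\<in>A. linear_extension z (g i))"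
  by (induction A rule: infinite_finite_induct) auto

lemma linear_extension_map_mult [simp]:
  "linear_extension z (Poly_Mapping.map ((*) a) h) = scale a (linear_extension z h)"
  using linear_extension_superset[OF _ keys_map_mult, of h z a]
  by (simp add: linear_extension_def lookup_map_mult scale_sum_right)

lemma linear_extension_cong:
  "(\<And>U. U \<in> Poly_Mapping.keys g \<Longrightarrow> z U = z' U) \<Longrightarrow> linear_extension z g = linear_extension z' g"
  by (simp add: linear_extension_def)

lemma linear_extension_scale:
  fixes g :: "'t \<Rightarrow>\<^sub>0 'k"
  shows "linear_extension (\<lambda>U. scale (a U) v) g = scale (\<Sum>U\<in>Poly_Mapping.keys g.
      Poly_Mapping.lookup g U * a U) v"
  by (simp add: linear_extension_def scale_sum_left)

lemma relation_holds_iff: "relation_holds scale Z t k T g \<longleftrightarrow> Z t k T = linear_extension (Z t k) g"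
  by (simp add: relation_holds_def linear_extension_def)

lemma Z_sum:
  assumes A: "wf_tangle P s m A w" and p: "p + k \<le> w" and B: "wf_tangle P s w B m"
    and v: "\<And>i. i \<in> F \<Longrightarrow> v i \<in> P k (shade_at s p)"
  shows "Z s m (A @ (p, Box k (\<Sum>i\<in>F. scale (c i) (v i))) # B)
      = (\<Sum>i\<in>F. scale (c i) (Z s m (A @ (p, Box k (v i)) # B)))"
proof -
  have wf: "wf_tangle P s m (A @ (p, Box k u) # B) m" if "u \<in> P k (shade_at s p)" for u
    using A p B that by (rule wf_insert_box)
  show ?thesis
    using v
  proof (induction F rule: infinite_finite_induct)
    case (insert x F)
    then have x: "v x \<in> P k (shade_at s p)" by simp
    have "(\<Sum>i\<in>F. scale (c i) (v i)) \<in> P k (shade_at s p)"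
      using insert by (intro subspace_sum subspace_P subspace_scale) auto
    with x insert show ?case
      by (simp add: Z_add wf Z_scale subspace_scale subspace_P)
  next
    case (infinite F)
    \<comment> \<open>A sum over an infinite set is \<open>0\<close> by convention, so the label is
      \<open>0\<close>, as for the empty sum; its value is obtained by scaling with
      \<open>0\<close>.\<close>
    show ?case using Z_scale[OF wf[OF subspace_0[OF subspace_P]], of 0] infinite by simp
  next
    case empty
    show ?case using Z_scale[OF wf[OF subspace_0[OF subspace_P]], of 0] by simp
  qed
qed

text \<open>A relation between small tangles passes to larger ones by composition: the inner tangle
  is folded into a single box, the label of the box is expanded, and every term is unfolded
  again.\<close>

lemma Z_local:
  assumes T: "wf_tangle P (shade_at s p) k T k" "Z (shade_at s p) k T = linear_extension (Z
      (shade_at s p) k) g"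
    and g: "\<And>U. U \<in> Poly_Mapping.keys g \<Longrightarrow> wf_tangle P (shade_at s p) k U k"
    and A: "wf_tangle P s m A w" and p: "p + k \<le> w" and B: "wf_tangle P s w B m"
  shows "Z s m (A @ place p T @ B) = linear_extension (\<lambda>U. Z s m (A @ place p U @ B)) g"
proof -
  have compose: "Z s m (A @ (p, Box k (Z (shade_at s p) k U)) # B) = Z s m (A @ place p U @ B)"
    if "wf_tangle P (shade_at s p) k U k" for U
    using that wf_insert_box[where L = P, OF A p B Z_in_P[OF that]] by (rule Z_compose)
  have "Z s m (A @ place p T @ B) = Z s m (A @ (p, Box k (Z (shade_at s p) k T)) # B)"
    using compose[OF T(1)] by simp
  also have "\<dots> = (\<Sum>U\<in>Poly_Mapping.keys g. scale (Poly_Mapping.lookup g U)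
      (Z s m (A @ (p, Box k (Z (shade_at s p) k U)) # B)))"
    unfolding T(2) linear_extension_def using g Z_in_P by (intro Z_sum[OF A p B]) auto
  also have "\<dots> = linear_extension (\<lambda>U. Z s m (A @ place p U @ B)) g"
    unfolding linear_extension_def using compose g by (intro sum.cong) auto
  finally show ?thesis .
qed

lemma Z_through_strings:
  assumes "wf_tangle P s m A w" "p + k \<le> w" "wf_tangle P s w B m"
  shows "Z s m (A @ (p, Box k (Z (shade_at s p) k [])) # B) = Z s m (A @ B)"
proof -
  have "Z (shade_at s p) k [] \<in> P k (shade_at s p)" by (intro Z_in_P) simp
  then have "wf_tangle P s m (A @ (p, Box k (Z (shade_at s p) k [])) # B) m"
    using assms by (intro wf_insert_box)
  then show ?thesis
    using Z_compose[of s p k "[]" m A B] by simp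
qed

end

section \<open>Soundness of the moves and reducibility\<close>

context two_box_yang_baxter
begin

abbreviation basis_wf :: "bool \<Rightarrow> nat \<Rightarrow> 'v tangle \<Rightarrow> nat \<Rightarrow> bool" where
  "basis_wf \<equiv> wf_tangle (basis_labels I S J X)"

lemma basis_mem: "i \<in> I t \<Longrightarrow> S i \<in> P 1 t" "j \<in> J t \<Longrightarrow> X j \<in> P 2 t"
  using one_box_basis(4)[of t] two_box_basis(4)[of t] span_base by blast+

lemma basis_labels_subset: "basis_labels I S J X k t \<subseteq> one_two_box_labels P k t"
  by (auto simp: basis_labels_def one_two_box_labels_def basis_mem[unfolded One_nat_def])

lemma one_two_box_labels_subset: "one_two_box_labels P k t \<subseteq> P k t"
  by (auto simp: one_two_box_labels_def)

lemma basis_wf_one_two: "basis_wf s m T n \<Longrightarrow> wf_tangle (one_two_box_labels P) s m T n"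
  by (rule wf_mono[OF basis_labels_subset])

lemma one_two_wf: "wf_tangle (one_two_box_labels P) s m T n \<Longrightarrow> wf_tangle P s m T n"
  by (rule wf_mono[OF one_two_box_labels_subset])

lemmas basis_wf_P = one_two_wf[OF basis_wf_one_two]

lemma local_move_sound:
  assumes "type_I_II_move I S J X K (shade_at s p) k T g \<or> type_III_move J X K (shade_at s p) k T g"
    and "wf_tangle P s m A w" "p + k \<le> w" "wf_tangle P s w B m"
  shows "Z s m (A @ place p T @ B) = linear_extension (\<lambda>U. Z s m (A @ place p U @ B)) g"
  using assms(1)
proof
  assume *: "type_I_II_move I S J X K (shade_at s p) k T g"
  then show ?thesis
    using type_I_II_move_wf[OF *] structure_constants[OF *, unfolded relation_holds_iff] assms(2-)
    by (intro Z_local) (auto intro: basis_wf_P)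
next
  assume *: "type_III_move J X K (shade_at s p) k T g"
  then show ?thesis
    using type_III_move_wf[where I = I and S = S, OF *] yang_baxter_relation[OF *, unfolded
        relation_holds_iff] assms(2-)
    by (intro Z_local) (auto intro: basis_wf_P)
qed

lemma move_sound:
  assumes "move scale P Z I S J X K s m T g"
  shows "Z s m T = linear_extension (Z s m) g"
  using assms
proof cases
  case (isotopy U)
  then show ?thesis
    using Z_isotopic[OF one_two_wf isotopic_mono[OF one_two_box_labels_subset]] by simp
next
  case (local_move p k T' g' A w B)
  show ?thesis
    unfolding local_move(1,2)
    using local_move_sound[OF local_move(3) one_two_wf[OF local_move(4)] local_move(5)
        one_two_wf[OF local_move(6)]]
    by (simp add: linear_extension_def[of _ g'])
next
  case (through_strings k A w p B)
  then show ?thesis using Z_through_strings[OF one_two_wf _ one_two_wf] by simp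
next
  case (linearity A p k u B v a b)
  note wf_u = one_two_wf[OF linearity(3)] and wf_v = one_two_wf[OF linearity(4)]
  from wf_u obtain w where w: "wf_tangle P s m A w" "p + k \<le> w" "wf_tangle P s w B m" "u \<in> P k
      (shade_at s p)"
    by (auto simp: wf_append)
  then have wf: "wf_tangle P s m (A @ (p, Box k x) # B) m" if "x \<in> P k (shade_at s p)" for x
    using that by (intro wf_insert_box)
  from wf_v have v: "v \<in> P k (shade_at s p)" by (auto simp: wf_append)
  show ?thesis
    unfolding linearity(1,2) using w(4) v wf by (simp add: Z_add Z_scale subspace_scale subspace_P)
qed

lemma reduces_sound:
  assumes "reduces scale P Z I S J X K s m T g"
  shows "Z s m T = linear_extension (Z s m) g"
  using assms
proof induction
  case (step T g h)
  have "Z s m T = linear_extension (Z s m) g" by (rule move_sound[OF step(1)])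
  also have "\<dots> = (\<Sum>U\<in>Poly_Mapping.keys g. scale (Poly_Mapping.lookup g U) (linear_extension (Z s
      m) (h U)))"
    unfolding linear_extension_def[of _ g] by (intro sum.cong refl arg_cong2[of _ _ _ _ scale]
        step(3))
  finally show ?case by simp
qed simp

definition reducible :: "bool \<Rightarrow> nat \<Rightarrow> 'v tangle set \<Rightarrow> 'v tangle \<Rightarrow> bool" where
  "reducible s m F T \<longleftrightarrow> (\<exists>g. reduces scale P Z I S J X K s m T g \<and> Poly_Mapping.keys g \<subseteq> F)"

lemma reducible_refl: "T \<in> F \<Longrightarrow> reducible s m F T"
  unfolding reducible_def by (intro exI[of _ "Poly_Mapping.single T 1"]) (auto intro: reduces.stop)

lemma reducible_move:
  assumes "move scale P Z I S J X K s m T g"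
    and "\<And>U. U \<in> Poly_Mapping.keys g \<Longrightarrow> reducible s m F U"
  shows "reducible s m F T"
proof -
  have "\<forall>U\<in>Poly_Mapping.keys g. \<exists>h. reduces scale P Z I S J X K s m U h \<and> Poly_Mapping.keys h \<subseteq> F"
    using assms(2) unfolding reducible_def by blast
  from bchoice[OF this] obtain h where h: "\<And>U. U \<in> Poly_Mapping.keys g \<Longrightarrow>
      reduces scale P Z I S J X K s m U (h U) \<and> Poly_Mapping.keys (h U) \<subseteq> F"
    by blast
  show ?thesis
    unfolding reducible_def
  proof (intro exI conjI)
    show "reduces scale P Z I S J X K s m T
        (\<Sum>U\<in>Poly_Mapping.keys g. Poly_Mapping.map ((*) (Poly_Mapping.lookup g U)) (h U))"
      by (rule reduces.step[OF assms(1)]) (simp add: h)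
    show "Poly_Mapping.keys (\<Sum>U\<in>Poly_Mapping.keys g. Poly_Mapping.map ((*) (Poly_Mapping.lookup g
        U)) (h U)) \<subseteq> F"
      by (intro keys_sum_subset order_trans[OF keys_map_mult]) (simp add: h)
  qed
qed

text \<open>The linearity move splits a label into two summands only, hence the induction over the
  span. Membership in \<open>P 2\<close> is carried along because each split needs well-formed
  summands.\<close>

lemma reducible_two_box:
  assumes A: "wf_tangle (one_two_box_labels P) s m A w" and p: "p + 2 \<le> w"
    and B: "wf_tangle (one_two_box_labels P) s w B m"
    and basis: "\<And>j. j \<in> J (shade_at s p) \<Longrightarrow> reducible s m F (A @ (p, Box 2 (X j)) # B)"
    and v: "v \<in> P 2 (shade_at s p)"
  shows "reducible s m F (A @ (p, Box 2 v) # B)"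
proof -
  let ?t = "shade_at s p"
  have wf: "wf_tangle (one_two_box_labels P) s m (A @ (p, Box 2 u) # B) m" if "u \<in> P 2 ?t" for u
    using A p B by (rule wf_insert_box) (use that in \<open>simp add: one_two_box_labels_def\<close>)
  from v have "v \<in> span (X ` J ?t)" unfolding two_box_basis(4) .
  then have "v \<in> P 2 ?t \<and> reducible s m F (A @ (p, Box 2 v) # B)"
  proof (induction rule: span_induct_alt)
    case base
    have 0: "0 \<in> P 2 ?t" by (rule subspace_0[OF subspace_P])
    \<comment> \<open>With \<open>a = b = 0\<close> the move rewrites the label \<open>0\<close> to
      the empty combination, of which nothing is left to reduce.\<close>
    from linearity[where scale = scale and P = P and I = I and S = S and J = J and X = X and K = K
        and a = 0 and b = 0, OF wf[OF 0] wf[OF 0]]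
    have "move scale P Z I S J X K s m (A @ (p, Box 2 0) # B) 0" by simp
    then have "reducible s m F (A @ (p, Box 2 0) # B)" by (rule reducible_move) simp
    with 0 show ?case ..
  next
    case (step c x y)
    from step(1) obtain j where j: "j \<in> J ?t" "x = X j" by blast
    then have x: "x \<in> P 2 ?t" by (simp add: basis_mem)
    from step(2) have y: "y \<in> P 2 ?t" "reducible s m F (A @ (p, Box 2 y) # B)" by blast+
    from linearity[where scale = scale and P = P and I = I and S = S and J = J and X = X and K = K
        and a = c and b = 1, OF wf[OF x] wf[OF y(1)]]
    have "reducible s m F (A @ (p, Box 2 (scale c x + scale 1 y)) # B)"
    proof (rule reducible_move)
      fix U
      assume "U \<in> Poly_Mapping.keys (Poly_Mapping.single (A @ (p, Box 2 x) # B) c +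
          Poly_Mapping.single (A @ (p, Box 2 y) # B) 1)"
      then have "U \<in> Poly_Mapping.keys (Poly_Mapping.single (A @ (p, Box 2 x) # B) c)
          \<union> Poly_Mapping.keys (Poly_Mapping.single (A @ (p, Box 2 y) # B) (1::'k))"
        by (rule subsetD[OF keys_add])
      then have "U = A @ (p, Box 2 x) # B \<or> U = A @ (p, Box 2 y) # B"
        by (auto split: if_splits)
      then show "reducible s m F U" using basis[OF j(1)] y(2) unfolding j(2) by blast
    qed
    moreover have "scale c x + y \<in> P 2 ?t"
      using x y by (intro subspace_add subspace_P subspace_scale)
    ultimately show ?case by simp
  qed
  then show ?thesis ..
qed

lemma reduction_reducible: "reduction I S J X K s m (reducible s m F)"
proof
  fix u v A B
  assume *: "isotopy_gen u v" "basis_wf s m (A @ u @ B) m" "basis_wf s m (A @ v @ B) m"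
  have iso: "isotopic (one_two_box_labels P) s m m (A @ u @ B) (A @ v @ B)"
    using * by (intro isotopic_step) (auto intro: basis_wf_one_two)
  show "reducible s m F (A @ u @ B) = reducible s m F (A @ v @ B)"
  proof
    assume "reducible s m F (A @ v @ B)"
    then show "reducible s m F (A @ u @ B)"
      by (intro reducible_move[OF move.isotopy[OF basis_wf_one_two[OF *(2)] iso]]) simp
  next
    assume "reducible s m F (A @ u @ B)"
    then show "reducible s m F (A @ v @ B)"
      by (intro reducible_move[OF move.isotopy[OF basis_wf_one_two[OF *(3)] isotopic_sym[OF
          iso]]]) simp
  qed
next
  fix p k T g A w B
  assume *: "type_I_II_move I S J X K (shade_at s p) k T g \<or> type_III_move J X K (shade_at s p) k
      T g"
    "basis_wf s m A w" "p + k \<le> w" "basis_wf s w B m"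
    and red: "\<And>U. U \<in> Poly_Mapping.keys g \<Longrightarrow> reducible s m F (A @ place p U @ B)"
  show "reducible s m F (A @ place p T @ B)"
  proof (rule reducible_move)
    show "move scale P Z I S J X K s m (A @ place p T @ B)
       (\<Sum>U\<in>Poly_Mapping.keys g. Poly_Mapping.single (A @ place p U @ B) (Poly_Mapping.lookup g U))"
      by (rule local_move[OF *(1) basis_wf_one_two[OF *(2)] *(3) basis_wf_one_two[OF *(4)]])
    fix V
    assume "V \<in> Poly_Mapping.keys (\<Sum>U\<in>Poly_Mapping.keys g. Poly_Mapping.single (A @ place p U @ B)
        (Poly_Mapping.lookup g U))"
    then obtain U where "U \<in> Poly_Mapping.keys g" "V = A @ place p U @ B"
      using keys_sum_single by fastforce
    then show "reducible s m F V" using red by simp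
  qed
next
  fix p A w B
  assume *: "basis_wf s m A w" "p + 2 \<le> w" "basis_wf s w B m"
    and red: "\<And>j. j \<in> J (shade_at s p) \<Longrightarrow> reducible s m F (A @ (p, Box 2 (X j)) # B)"
  show "reducible s m F (A @ B)"
  proof (rule reducible_move)
    \<comment> \<open>The through strings become a 2-box labelled by the identity, which need not be
      a basis element; its label is expanded afterwards.\<close>
    show "move scale P Z I S J X K s m (A @ B)
       (Poly_Mapping.single (A @ (p, Box 2 (Z (shade_at s p) 2 [])) # B) 1)"
      by (rule through_strings[OF _ basis_wf_one_two[OF *(1)] *(2) basis_wf_one_two[OF *(3)]]) simp
    have "Z (shade_at s p) 2 [] \<in> P 2 (shade_at s p)" by (intro Z_in_P) simp
    from reducible_two_box[OF basis_wf_one_two[OF *(1)] *(2) basis_wf_one_two[OF *(3)] red this]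
    have "reducible s m F (A @ (p, Box 2 (Z (shade_at s p) 2 [])) # B)" .
    then show "reducible s m F U"
      if "U \<in> Poly_Mapping.keys (Poly_Mapping.single (A @ (p, Box 2 (Z (shade_at s p) 2 [])) # B)
          (1::'k))" for U
      using that by simp
  qed
qed

text \<open>Given labels are arbitrary vectors, whereas the normal form argument treats basis
  labels. \<open>A\<close> is the part already expanded, and \<open>B\<close> is processed layer by
  layer.\<close>

lemma reducible_basis_expansion:
  assumes "basis_wf s m A w" "wf_tangle (two_box_labels (P 2)) s w B m"
    and "\<And>T. basis_wf s m T m \<Longrightarrow> reducible s m F T"
  shows "reducible s m F (A @ B)"
  using assms(1,2)
proof (induction B arbitrary: A w)
  case Nil
  then show ?case using assms(3) by simp
next
  case (Cons l B)
  obtain p c where l: "l = (p, c)" by (cases l)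
  have wfB: "wf_tangle (two_box_labels (P 2)) s (w - ins c + outs c) B m" and p: "p + ins c \<le> w"
    using Cons.prems(2) by (auto simp: l)
  have other: "reducible s m F (A @ l # B)" if "basis_wf s m (A @ [l]) (w - ins c + outs c)"
    using Cons.IH[OF that wfB] by simp
  show ?case
  proof (cases c)
    case (Box k v)
    with Cons.prems(2) have k: "k = 2" and v: "v \<in> P 2 (shade_at s p)"
      by (auto simp: l two_box_labels_def split: if_splits)
    have wfB': "wf_tangle (two_box_labels (P 2)) s w B m" using wfB p Box by simp
    have "reducible s m F (A @ (p, Box 2 v) # B)"
    proof (rule reducible_two_box)
      show "wf_tangle (one_two_box_labels P) s m A w" "p + 2 \<le> w"
        using basis_wf_one_two[OF Cons.prems(1)] p Box k by simp_all
      show "wf_tangle (one_two_box_labels P) s w B m"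
        by (rule wf_mono[OF _ wfB']) (auto simp: two_box_labels_def one_two_box_labels_def)
      fix j assume "j \<in> J (shade_at s p)"
      then have "basis_wf s m (A @ [(p, Box 2 (X j))]) w"
        using Cons.prems(1) p Box k by (auto simp: wf_append)
      from Cons.IH[OF this wfB'] show "reducible s m F (A @ (p, Box 2 (X j)) # B)" by simp
    qed (rule v)
    then show ?thesis using Box l k by simp
  next
    case Cup
    show ?thesis by (rule other) (use Cons.prems(1) Cup l p in \<open>auto simp: wf_append\<close>)
  next
    case Cap
    show ?thesis by (rule other) (use Cons.prems(1) Cap l p in \<open>auto simp: wf_append\<close>)
  qed
qed

end

lemma finite_tangles_of_shape:
  assumes "\<And>k t. finite (L k t)"
  shows "finite {T. fill (\<lambda>_. ()) T = W \<and> wf_tangle L s m T n}"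
proof (induction W arbitrary: m)
  case Nil
  show ?case by (rule finite_subset[of _ "{[]}"]) auto
next
  case (Cons l W)
  obtain p c where l: "l = (p, c)" by (cases l)
  let ?m = "m - ins c + outs c"
  \<comment> \<open>The shape fixes the position and the kind of the piece, so only the label of a
    box is free; for a box \<open>ins c\<close> is its size.\<close>
  let ?C = "{Cup, Cap} \<union> (\<Union>k\<in>{ins c}. Box k ` L k (shade_at s p))"
  let ?F = "{T. fill (\<lambda>_. ()) T = W \<and> wf_tangle L s ?m T n}"
  have "{T. fill (\<lambda>_. ()) T = l # W \<and> wf_tangle L s m T n} \<subseteq> (\<lambda>(d, T). (p, d) # T) ` (?C \<times> ?F)"
  proof
    fix T assume "T \<in> {T. fill (\<lambda>_. ()) T = l # W \<and> wf_tangle L s m T n}"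
    then obtain d T' where T: "T = (p, d) # T'" "map_piece (\<lambda>_. ()) d = c" "fill (\<lambda>_. ()) T' = W"
      "wf_tangle L s m T n"
      by (auto simp: l fill_eq_Cons)
    then have "ins d = ins c" "outs d = outs c" by auto
    with T have "T' \<in> ?F" "d \<in> ?C" by (auto split: piece.splits)
    with T show "T \<in> (\<lambda>(d, T). (p, d) # T) ` (?C \<times> ?F)" by force
  qed
  moreover have "finite (?C \<times> ?F)" using Cons.IH assms by auto
  ultimately show ?case by (rule finite_subset[OF _ finite_imageI])
qed

context two_box_yang_baxter
begin

lemma finite_basis_labels: "finite (basis_labels I S J X k t)"
  by (auto simp: basis_labels_def one_box_basis two_box_basis)

lemma evaluable:
  "\<exists>F. finite F \<and> (\<forall>U\<in>F. basis_wf s m U m \<and> fill (\<lambda>_. ()) U = normal_word m) \<and>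
     (\<forall>T. wf_tangle (two_box_labels (P 2)) s m T m \<longrightarrow> reducible s m F T)"
proof -
  define F where "F = {U. fill (\<lambda>_. ()) U = normal_word m \<and> basis_wf s m U m}"
  interpret reduction I S J X K s m "reducible s m F" by (rule reduction_reducible)
  have "reducible s m F T" if "wf_tangle (two_box_labels (P 2)) s m T m" for T
  proof -
    have "reducible s m F U" if "basis_wf s m U m" for U
      by (rule good_if_normal_good[OF that], rule reducible_refl) (simp add: F_def shape_def)
    from reducible_basis_expansion[of s m "[]" m T, OF _ that this] show ?thesis by simp
  qed
  moreover have "finite F"
    unfolding F_def by (rule finite_tangles_of_shape[OF finite_basis_labels])
  ultimately show ?thesis by (intro exI[of _ F]) (auto simp: F_def)
qed

lemma span_reduced:
  assumes wf: "\<forall>U\<in>F. basis_wf s m U m"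
    and red: "\<forall>T. wf_tangle (two_box_labels (P 2)) s m T m \<longrightarrow> reducible s m F T"
  shows "P m s = span (Z s m ` F)"
proof
  have "Z s m T \<in> span (Z s m ` F)" if "wf_tangle (two_box_labels (P 2)) s m T m" for T
  proof -
    from red that obtain g where g: "reduces scale P Z I S J X K s m T g" "Poly_Mapping.keys g \<subseteq> F"
      unfolding reducible_def by blast
    show ?thesis
      unfolding reduces_sound[OF g(1)] linear_extension_def
      using g(2) by (intro span_sum span_scale span_base) blast
  qed
  then show "P m s \<subseteq> span (Z s m ` F)"
    unfolding generated_by_two_boxes[of m s] by (intro span_minimal subspace_span) blast
  show "span (Z s m ` F) \<subseteq> P m s"
    using wf by (intro span_minimal subspace_P) (auto intro!: Z_in_P basis_wf_P)
qed

section \<open>The unit of the algebra of 2-boxes\<close>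

lemma Z_product:
  assumes "j \<in> J t" "k \<in> J t"
  shows "Z t 2 [(0, Box 2 (X k)), (0, Box 2 (X j))] = (\<Sum>l\<in>J t. scale (coeff_II K t j 0 t k 0 l) (X
      l))"
proof -
  from type_II[where S = S and X = X and I = I and K = K and J = J and r = 0 and r' = 0, OF
      assms(1) _ assms(2)]
  have "type_I_II_move I S J X K t 2 (stack (box 2 (X j)) (box 2 (X k)))
      (\<Sum>l\<in>J t. Poly_Mapping.single (box 2 (X l)) (coeff_II K t j 0 t k 0 l))"
    by simp
  from structure_constants[OF this, unfolded relation_holds_iff]
  have "Z t 2 (stack (box 2 (X j)) (box 2 (X k))) = (\<Sum>l\<in>J t. scale (coeff_II K t j 0 t k 0 l) (Z t
      2 (box 2 (X l))))"
    by simp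
  also have "\<dots> = (\<Sum>l\<in>J t. scale (coeff_II K t j 0 t k 0 l) (X l))"
    by (intro sum.cong) (simp_all add: box_def Z_identity basis_mem)
  finally show ?thesis by (simp add: stack_def box_def)
qed

text \<open>The lower layer is the right factor: these are the coordinates of a combination
  multiplied on the right by \<open>X k\<close>, which turns the unit equations into equations
  between coefficients.\<close>

lemma Z_right_product:
  assumes "k \<in> J t"
  shows "Z t 2 [(0, Box 2 (X k)), (0, Box 2 (\<Sum>j\<in>J t. scale (e j) (X j)))]
    = (\<Sum>l\<in>J t. scale (\<Sum>j\<in>J t. e j * coeff_II K t j 0 t k 0 l) (X l))"
proof -
  have "Z t 2 ([(0, Box 2 (X k))] @ (0, Box 2 (\<Sum>j\<in>J t. scale (e j) (X j))) # [])
      = (\<Sum>j\<in>J t. scale (e j) (Z t 2 ([(0, Box 2 (X k))] @ (0, Box 2 (X j)) # [])))"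
    by (rule Z_sum[where w = 2]) (use assms in \<open>auto simp: basis_mem\<close>)
  also have "\<dots> = (\<Sum>j\<in>J t. \<Sum>l\<in>J t. scale (e j * coeff_II K t j 0 t k 0 l) (X l))"
    using assms by (intro sum.cong) (simp_all add: Z_product scale_sum_right)
  also have "\<dots> = (\<Sum>l\<in>J t. scale (\<Sum>j\<in>J t. e j * coeff_II K t j 0 t k 0 l) (X l))"
    by (subst sum.swap) (simp add: scale_sum_left)
  finally show ?thesis by simp
qed

lemma basis_coefficients_unique:
  assumes "(\<Sum>l\<in>J t. scale (a l) (X l)) = (\<Sum>l\<in>J t. scale (b l) (X l))" "l \<in> J t"
  shows "a l = b l"
proof -
  \<comment> \<open>Independence speaks of coefficients indexed by vectors; \<open>inv_into\<close>
    reindexes those given on \<open>J t\<close>.\<close>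
  let ?u = "\<lambda>v. a (inv_into (J t) X v) - b (inv_into (J t) X v)"
  have "(\<Sum>v\<in>X ` J t. scale (?u v) v) = (\<Sum>l\<in>J t. scale (a l - b l) (X l))"
    using two_box_basis(2)[of t] by (simp add: sum.reindex)
  also have "\<dots> = 0" using assms(1) by (simp add: scale_left_diff_distrib sum_subtractf)
  finally have "?u (X l) = 0"
    using independentD[OF two_box_basis(3) _ order_refl, of t ?u "X l"] two_box_basis(1)[of t]
        assms(2)
    by simp
  then show ?thesis using two_box_basis(2)[of t] assms(2) by simp
qed

text \<open>The identity of the algebra of 2-boxes is its only unit, so its coordinates depend only on the
  structure constants.\<close>

definition unit_coords :: "bool \<Rightarrow> ('j \<Rightarrow> 'k) \<Rightarrow> bool" where
  "unit_coords t e \<longleftrightarrow> (\<forall>k\<in>J t. \<forall>l\<in>J t.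
     (\<Sum>j\<in>J t. e j * coeff_II K t j 0 t k 0 l) = (if l = k then 1 else 0))"

text \<open>The coordinates of two parallel strings solve the system, since stacking these strings
  on a 2-box does not change it.\<close>

lemma unit_coords_exist: "\<exists>e. unit_coords t e"
proof -
  have "Z t 2 [] \<in> span (X ` J t)" unfolding two_box_basis(4) by (intro Z_in_P) simp
  then obtain u where u: "Z t 2 [] = (\<Sum>v\<in>X ` J t. scale (u v) v)"
    using two_box_basis(1)[of t] by (auto simp: span_finite)
  define e where "e = (\<lambda>j. u (X j))"
  have e: "Z t 2 [] = (\<Sum>j\<in>J t. scale (e j) (X j))"
    using two_box_basis(2)[of t] by (simp add: u e_def sum.reindex)
  have "unit_coords t e"
    unfolding unit_coords_def
  proof (intro ballI)
    fix k l assume k: "k \<in> J t" and l: "l \<in> J t"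
    have "(\<Sum>l\<in>J t. scale (\<Sum>j\<in>J t. e j * coeff_II K t j 0 t k 0 l) (X l)) = Z t 2 ([(0, Box 2 (X
        k))] @ (0, Box 2 (Z t 2 [])) # [])"
      by (simp add: e Z_right_product[OF k])
    also have "\<dots> = X k"
      using Z_through_strings[of t 2 "[(0, Box 2 (X k))]" 2 0 2 "[]"] k
      by (simp add: basis_mem Z_identity)
    also have "\<dots> = (\<Sum>l\<in>J t. scale (if l = k then 1 else 0) (X l))"
      using k two_box_basis(1)[of t] by (simp add: if_distrib[of "\<lambda>a. scale a _"] sum.delta cong:
          if_cong)
    finally show "(\<Sum>j\<in>J t. e j * coeff_II K t j 0 t k 0 l) = (if l = k then 1 else 0)"
      by (rule basis_coefficients_unique[OF _ l])
  qed
  then show ?thesis by blast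
qed

text \<open>The usual uniqueness of a unit. It makes a solution found in one planar algebra describe
  the parallel strings in every other one with the same coefficients.\<close>

lemma unit_coords_identity:
  assumes "unit_coords t e"
  shows "Z t 2 [] = (\<Sum>j\<in>J t. scale (e j) (X j))"
proof -
  let ?u = "\<Sum>j\<in>J t. scale (e j) (X j)"
  have u: "?u \<in> P 2 t" by (intro subspace_sum subspace_P subspace_scale) (simp add: basis_mem)
  have right_unit: "Z t 2 [(0, Box 2 (X k)), (0, Box 2 ?u)] = X k" if k: "k \<in> J t" for k
  proof -
    have "Z t 2 [(0, Box 2 (X k)), (0, Box 2 ?u)] = (\<Sum>l\<in>J t. scale (if l = k then 1 else 0) (X l))"
      unfolding Z_right_product[OF k] using assms k by (intro sum.cong) (auto simp: unit_coords_def)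
    also have "\<dots> = X k"
      using k two_box_basis(1)[of t] by (simp add: if_distrib[of "\<lambda>a. scale a _"] sum.delta cong:
          if_cong)
    finally show ?thesis .
  qed
  have "Z t 2 [] \<in> span (X ` J t)" unfolding two_box_basis(4) by (intro Z_in_P) simp
  then obtain d where d: "Z t 2 [] = (\<Sum>v\<in>X ` J t. scale (d v) v)"
    using two_box_basis(1)[of t] by (auto simp: span_finite)
  then have d': "Z t 2 [] = (\<Sum>j\<in>J t. scale (d (X j)) (X j))"
    using two_box_basis(2)[of t] by (simp add: sum.reindex)
  \<comment> \<open>The product of \<open>?u\<close> with the identity is computed twice: it is
    \<open>?u\<close> because through strings change nothing, and it is the identity because
    \<open>?u\<close> fixes each basis element in the expansion.\<close>
  have "?u = Z t 2 [(0, Box 2 ?u)]" using u by (simp add: Z_identity)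
  also have "\<dots> = Z t 2 ([] @ (0, Box 2 (Z t 2 [])) # [(0, Box 2 ?u)])"
    using Z_through_strings[of t 2 "[]" 2 0 2 "[(0, Box 2 ?u)]"] u by simp
  also have "\<dots> = (\<Sum>j\<in>J t. scale (d (X j)) (Z t 2 ([] @ (0, Box 2 (X j)) # [(0, Box 2 ?u)])))"
    unfolding d' by (rule Z_sum[where w = 2]) (use u in \<open>auto simp: basis_mem\<close>)
  also have "\<dots> = Z t 2 []"
    unfolding d' using right_unit by (intro sum.cong) auto
  finally show ?thesis by simp
qed

text \<open>Labels that are indices instead of vectors let one tangle be evaluated in two planar
    algebras.\<close>

abbreviation index_wf :: "bool \<Rightarrow> nat \<Rightarrow> ('i + 'j) tangle \<Rightarrow> nat \<Rightarrow> bool" where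
  "index_wf \<equiv> wf_tangle (basis_labels I Inl J Inr)"

definition tangle_value :: "bool \<Rightarrow> nat \<Rightarrow> ('i + 'j) tangle \<Rightarrow> 'v" where
  "tangle_value s m T = Z s m (fill (case_sum S X) T)"

lemma index_wf_basis_wf: "index_wf s m T n \<Longrightarrow> basis_wf s m (fill (case_sum S X) T) n"
  by (erule wf_fill[rotated]) (auto simp: basis_labels_def split: if_splits)

lemmas index_wf_P = basis_wf_P[OF index_wf_basis_wf]

lemma tangle_value_isotopy:
  assumes "isotopy_gen u v" "index_wf s m (A @ u @ B) m" "index_wf s m (A @ v @ B) m"
  shows "tangle_value s m (A @ u @ B) = tangle_value s m (A @ v @ B)"
  unfolding tangle_value_def
  using index_wf_P[OF assms(2)] index_wf_P[OF assms(3)]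
  by (intro Z_isotopic) (auto intro!: isotopic_step isotopy_gen_fill assms(1))

text \<open>Filling in vectors may identify different tangles, so the two formal combinations are
  compared only through the linear extension of an arbitrary \<open>z\<close>.\<close>

lemma index_move:
  assumes "type_I_II_move I Inl J Inr K t k T g \<or> type_III_move J Inr K t k T g"
  obtains g' where
    "type_I_II_move I S J X K t k (fill (case_sum S X) T) g' \<or> type_III_move J X K t k (fill
        (case_sum S X) T) g'"
    "\<And>z. linear_extension (\<lambda>U. z (fill (case_sum S X) U)) g = linear_extension z g'"
proof -
  have "\<exists>g'. (type_I_II_move I S J X K t k (fill (case_sum S X) T) g' \<or> type_III_move J X K t k
      (fill (case_sum S X) T) g') \<and>
    (\<forall>z. linear_extension (\<lambda>U. z (fill (case_sum S X) U)) g = linear_extension z g')"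
    using assms
  proof
    assume "type_I_II_move I Inl J Inr K t k T g"
    then show ?thesis
    proof cases
      case (type_I j s r)
      from type_I_II_move.type_I[where S = S and X = X and I = I and K = K and J = J, OF
          type_I(5,6)]
      show ?thesis unfolding type_I(1-4) by (intro exI conjI disjI1) (auto)
    next
      case (type_I' i s r)
      from type_I_II_move.type_I'[where S = S and X = X and I = I and K = K and J = J, OF
          type_I'(5,6)]
      show ?thesis unfolding type_I'(1-4) by (intro exI conjI disjI1) (auto)
    next
      case (type_II j s r k' s' r')
      from type_I_II_move.type_II[where S = S and X = X and I = I and K = K and J = J, OF
          type_II(4-9)]
      show ?thesis unfolding type_II(1-3) by (intro exI conjI disjI1) (auto)
    next
      case (type_II' i s j c r U)
      from type_I_II_move.type_II'[where S = S and X = X and I = I and K = K and J = J, OF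
          type_II'(4-8) refl]
      show ?thesis unfolding type_II' by (intro exI conjI disjI1) (auto)
    qed
  next
    assume "type_III_move J Inr K t k T g"
    then show ?thesis
    proof cases
      case (type_III i j l)
      from type_III_move.type_III[where X = X and K = K and J = J, OF type_III(4-6)]
      show ?thesis unfolding type_III(1-3) by (intro exI conjI disjI2) (auto)
    qed
  qed
  with that show ?thesis by blast
qed

lemma tangle_value_local:
  assumes "type_I_II_move I Inl J Inr K (shade_at s p) k T g \<or> type_III_move J Inr K (shade_at s
      p) k T g"
    and A: "index_wf s m A w" and p: "p + k \<le> w" and B: "index_wf s w B m"
  shows "tangle_value s m (A @ place p T @ B) = linear_extension (\<lambda>U. tangle_value s m (A @ place
      p U @ B)) g"
proof -
  let ?f = "fill (case_sum S X)"
  from index_move[OF assms(1)] obtain g' where g':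
    "type_I_II_move I S J X K (shade_at s p) k (?f T) g' \<or> type_III_move J X K (shade_at s p) k
        (?f T) g'"
    "\<And>z. linear_extension (\<lambda>U. z (?f U)) g = linear_extension z g'" by blast
  from local_move_sound[OF g'(1) index_wf_P[OF A] p index_wf_P[OF B]]
  show ?thesis unfolding g'(2)[symmetric] by (simp add: tangle_value_def)
qed

lemma tangle_value_insert:
  assumes e: "unit_coords (shade_at s p) e"
    and A: "index_wf s m A w" and p: "p + 2 \<le> w" and B: "index_wf s w B m"
  shows "tangle_value s m (A @ B) = (\<Sum>j\<in>J (shade_at s p). scale (e j) (tangle_value s m (A @ (p,
      Box 2 (Inr j)) # B)))"
proof -
  let ?f = "fill (case_sum S X)"
  have "Z s m (?f A @ ?f B) = Z s m (?f A @ (p, Box 2 (Z (shade_at s p) 2 [])) # ?f B)"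
    by (rule Z_through_strings[symmetric, OF index_wf_P[OF A] p index_wf_P[OF B]])
  also have "\<dots> = (\<Sum>j\<in>J (shade_at s p). scale (e j) (Z s m (?f A @ (p, Box 2 (X j)) # ?f B)))"
    unfolding unit_coords_identity[OF e]
    by (rule Z_sum[OF index_wf_P[OF A] p index_wf_P[OF B]]) (simp add: basis_mem)
  finally show ?thesis by (simp add: tangle_value_def)
qed

end

text \<open>Each move preserves the existence of a common scalar, since both planar algebras use the
  same \<open>K\<close> and hence expand a tangle with the same coefficients. The scalar itself is
  never computed.\<close>

lemma same_closed_value:
  fixes scale :: "'k::field \<Rightarrow> 'v::ab_group_add \<Rightarrow> 'v" and scale' :: "'k \<Rightarrow> 'w::ab_group_add \<Rightarrow> 'w"
    and I :: "bool \<Rightarrow> 'i set" and J :: "bool \<Rightarrow> 'j set" and K :: "('i, 'j, 'k) coeffs"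
  assumes "two_box_yang_baxter scale P Z I S J X K" "two_box_yang_baxter scale' P' Z' I S' J X' K"
    and T: "wf_tangle (two_box_labels J) s 0 T 0"
  shows "\<exists>a. Z s 0 (fill X T) = scale a (Z s 0 []) \<and> Z' s 0 (fill X' T) = scale' a (Z' s 0 [])"
proof -
  interpret A: two_box_yang_baxter scale P Z I S J X K by fact
  interpret B: two_box_yang_baxter scale' P' Z' I S' J X' K by fact
  define good where "good T \<longleftrightarrow> (\<exists>a. A.tangle_value s 0 T = scale a (Z s 0 []) \<and>
    B.tangle_value s 0 T = scale' a (Z' s 0 []))" for T :: "('i + 'j) tangle"
  \<comment> \<open>The separate map \<open>h\<close> allows \<open>g\<close> to be a combination of
    tangles for a move, or of basis indices for an inserted box.\<close>
  have good_extension: "good T"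
    if "A.tangle_value s 0 T = A.linear_extension (\<lambda>U. A.tangle_value s 0 (h U)) g"
      "B.tangle_value s 0 T = B.linear_extension (\<lambda>U. B.tangle_value s 0 (h U)) g"
      "\<And>U. U \<in> Poly_Mapping.keys g \<Longrightarrow> good (h U)"
    for T and h :: "'t \<Rightarrow> ('i + 'j) tangle" and g :: "'t \<Rightarrow>\<^sub>0 'k"
  proof -
    have "\<forall>U\<in>Poly_Mapping.keys g. \<exists>a. A.tangle_value s 0 (h U) = scale a (Z s 0 []) \<and>
        B.tangle_value s 0 (h U) = scale' a (Z' s 0 [])"
      using that(3) unfolding good_def by blast
    from bchoice[OF this] obtain a where a:
      "\<And>U. U \<in> Poly_Mapping.keys g \<Longrightarrow> A.tangle_value s 0 (h U) = scale (a U) (Z s 0 [])"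
      "\<And>U. U \<in> Poly_Mapping.keys g \<Longrightarrow> B.tangle_value s 0 (h U) = scale' (a U) (Z' s 0 [])" by blast
    let ?a = "\<Sum>U\<in>Poly_Mapping.keys g. Poly_Mapping.lookup g U * a U"
    have "A.tangle_value s 0 T = scale ?a (Z s 0 [])"
      unfolding that(1) A.linear_extension_scale[symmetric] by (rule A.linear_extension_cong)
          (rule a(1))
    moreover have "B.tangle_value s 0 T = scale' ?a (Z' s 0 [])"
      unfolding that(2) B.linear_extension_scale[symmetric] by (rule B.linear_extension_cong)
          (rule a(2))
    ultimately show ?thesis unfolding good_def by blast
  qed
  interpret reduction I Inl J Inr K s 0 good
  proof
    fix u v :: "('i + 'j) tangle" and C D
    assume "isotopy_gen u v" "A.index_wf s 0 (C @ u @ D) 0" "A.index_wf s 0 (C @ v @ D) 0"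
    then show "good (C @ u @ D) = good (C @ v @ D)"
      by (simp only: good_def A.tangle_value_isotopy B.tangle_value_isotopy)
  next
    fix p k T g C w D
    assume *: "type_I_II_move I Inl J Inr K (shade_at s p) k T g \<or> type_III_move J Inr K (shade_at
        s p) k T g"
      "A.index_wf s 0 C w" "p + k \<le> w" "A.index_wf s w D 0"
      "\<And>U. U \<in> Poly_Mapping.keys g \<Longrightarrow> good (C @ place p U @ D)"
    show "good (C @ place p T @ D)"
      by (rule good_extension[OF A.tangle_value_local[OF *(1-4)] B.tangle_value_local[OF *(1-4)]
          *(5)])
  next
    fix p C w D
    let ?t = "shade_at s p"
    assume *: "A.index_wf s 0 C w" "p + 2 \<le> w" "A.index_wf s w D 0"
      and good: "\<And>j. j \<in> J ?t \<Longrightarrow> good (C @ (p, Box 2 (Inr j)) # D)"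
    \<comment> \<open>\<open>unit_coords\<close> depends only on \<open>J\<close> and
      \<open>K\<close>, so \<open>e\<close> serves the second planar algebra as well and the two
      expansions agree.\<close>
    obtain e where e: "A.unit_coords ?t e" using A.unit_coords_exist by blast
    define g where "g = (\<Sum>j\<in>J ?t. Poly_Mapping.single j (e j))"
    have "good (C @ D)"
    proof (rule good_extension[of "C @ D" "\<lambda>j. C @ (p, Box 2 (Inr j)) # D" g])
      show "A.tangle_value s 0 (C @ D) = A.linear_extension (\<lambda>j. A.tangle_value s 0 (C @ (p, Box 2
          (Inr j)) # D)) g"
        unfolding A.tangle_value_insert[OF e *] g_def by simp
      show "B.tangle_value s 0 (C @ D) = B.linear_extension (\<lambda>j. B.tangle_value s 0 (C @ (p, Box 2
          (Inr j)) # D)) g"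
        unfolding B.tangle_value_insert[OF e *] g_def by simp
      fix j assume "j \<in> Poly_Mapping.keys g"
      then show "good (C @ (p, Box 2 (Inr j)) # D)"
        unfolding g_def using keys_sum_single[of "\<lambda>j. j" e "J ?t"] good by auto
    qed
    then show "good (C @ D)" .
  qed
  have "wf 0 (fill Inr T) 0"
    by (rule wf_fill[OF _ T]) (auto simp: two_box_labels_def split: if_splits)
  then have "good (fill Inr T)"
  proof (rule good_if_normal_good)
    fix U assume "shape U = normal_word 0"
    then have "U = []" by (simp add: shape_def)
    then show "good U" unfolding good_def A.tangle_value_def B.tangle_value_def by (auto intro!:
        exI[of _ 1])
  qed
  then show ?thesis
    unfolding good_def A.tangle_value_def B.tangle_value_def by (simp add: fill_case_sum_Inr)
qed

theorem theorem3p4: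
  fixes scale :: "'k::field \<Rightarrow> 'v::ab_group_add \<Rightarrow> 'v"
    and P :: "nat \<Rightarrow> bool \<Rightarrow> 'v set"
    and Z :: "bool \<Rightarrow> nat \<Rightarrow> 'v tangle \<Rightarrow> 'v"
    and I :: "bool \<Rightarrow> 'i set" and S :: "'i \<Rightarrow> 'v"
    and J :: "bool \<Rightarrow> 'j set" and X :: "'j \<Rightarrow> 'v"
    and K :: "('i, 'j, 'k) coeffs"
  assumes "two_box_yang_baxter scale P Z I S J X K"
  shows "(\<forall>s T. wf_tangle (two_box_labels (P 2)) s 0 T 0 \<longrightarrow>
           (\<exists>a. reduces scale P Z I S J X K s 0 T (Poly_Mapping.single [] a))) \<and>
         (\<forall>s m. \<exists>F. finite F \<and>
           (\<forall>U\<in>F. wf_tangle (one_two_box_labels P) s m U m) \<and>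
           (\<forall>T. wf_tangle (two_box_labels (P 2)) s m T m \<longrightarrow>
              (\<exists>g. reduces scale P Z I S J X K s m T g \<and> Poly_Mapping.keys g \<subseteq> F)) \<and>
           P m s = module.span scale (Z s m ` F)) \<and>
         (\<forall>(scale' :: 'k \<Rightarrow> 'w::ab_group_add \<Rightarrow> 'w) P' Z' S' X'.
           two_box_yang_baxter scale' P' Z' I S' J X' K \<longrightarrow>
           (\<forall>s T. wf_tangle (two_box_labels J) s 0 T 0 \<longrightarrow>
              (\<forall>a. Z s 0 (fill X T) = scale a (Z s 0 []) \<longleftrightarrow>
                   Z' s 0 (fill X' T) = scale' a (Z' s 0 []))))"
proof (intro conjI allI impI)
  interpret two_box_yang_baxter scale P Z I S J X K by fact
  fix s m
  show "\<exists>a. reduces scale P Z I S J X K s 0 T (Poly_Mapping.single [] a)"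
    if T: "wf_tangle (two_box_labels (P 2)) s 0 T 0" for T
  proof -
    from evaluable[of s 0] T obtain F where "\<And>U. U \<in> F \<Longrightarrow> fill (\<lambda>_. ()) U = normal_word 0"
        "reducible s 0 F T"
      by blast
    then have F: "F \<subseteq> {[]}" "reducible s 0 F T" by auto
    then obtain g where g: "reduces scale P Z I S J X K s 0 T g" "Poly_Mapping.keys g \<subseteq> {[]}"
      unfolding reducible_def by blast
    \<comment> \<open>The normal word on no strings is empty, so the empty tangle is the only one
      that can occur in \<open>g\<close>.\<close>
    then have "g = Poly_Mapping.single [] (Poly_Mapping.lookup g [])"
      by (intro poly_mapping_eqI) (auto simp: lookup_single when_def in_keys_iff)
    with g(1) show ?thesis by metis
  qed
  from evaluable[of s m] obtain F where F: "finite F" "\<forall>U\<in>F. basis_wf s m U m"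
    "\<forall>T. wf_tangle (two_box_labels (P 2)) s m T m \<longrightarrow> reducible s m F T" by blast
  have "\<forall>U\<in>F. wf_tangle (one_two_box_labels P) s m U m" using F(2) basis_wf_one_two by blast
  with F span_reduced[OF F(2,3)]
  show "\<exists>F. finite F \<and> (\<forall>U\<in>F. wf_tangle (one_two_box_labels P) s m U m) \<and>
      (\<forall>T. wf_tangle (two_box_labels (P 2)) s m T m \<longrightarrow>
         (\<exists>g. reduces scale P Z I S J X K s m T g \<and> Poly_Mapping.keys g \<subseteq> F)) \<and>
      P m s = module.span scale (Z s m ` F)"
    unfolding reducible_def by blast
next
  fix scale' :: "'k \<Rightarrow> 'w \<Rightarrow> 'w" and P' Z' S' X' s T a
  assume B: "two_box_yang_baxter scale' P' Z' I S' J X' K" and T: "wf_tangle (two_box_labels J) s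
      0 T 0"
  interpret A: two_box_yang_baxter scale P Z I S J X K by fact
  interpret B: two_box_yang_baxter scale' P' Z' I S' J X' K by fact
  from same_closed_value[OF assms B T] obtain b
    where "Z s 0 (fill X T) = scale b (Z s 0 [])" "Z' s 0 (fill X' T) = scale' b (Z' s 0 [])" by
        blast
  \<comment> \<open>The empty diagram is nonzero in both planar algebras, so either equation holds
    exactly when \<open>a = b\<close>.\<close>
  then show "Z s 0 (fill X T) = scale a (Z s 0 []) \<longleftrightarrow> Z' s 0 (fill X' T) = scale' a (Z' s 0 [])"
    using A.P0_one_dim(1) B.P0_one_dim(1) by simp
qed

end
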